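(* Let $N\ge2$, $1<p\le N$ and $\gamma>p-1$. Let $q\in[p,p^*]$ with $p^*=Np/(N-p)$ if $1<p<N$, and $q\in[p,\infty)$ if $p=N$. Then there exists a constant $C_0>0$ such that $$\left(\int_{\mathbb{R}^N_+}\frac{|u|^q}{(1+x_N)^{p-\gamma}}\,dx\right)^{p/q}\le C_0\int_{\mathbb{R}^N_+}(1+x_N)^\gamma|\nabla u|^p\,dx,\qquad\forall\,u\in\mathcal{D}^{1,p}_\gamma(\mathbb{R}^N_+).$$
   Context: $\mathbb{R}^N_+=\{(x',x_N): x'\in\mathbb{R}^{N-1},\ x_N>0\}$. $C_\delta^\infty(\mathbb{R}^N_+)$ is the set of restrictions to $\mathbb{R}^N_+$ of functions in $C_0^\infty(\mathbb{R}^N)$. $\mathcal{D}^{1,p}_\gamma(\mathbb{R}^N_+)$ is the completion of $C_\delta^\infty(\mathbb{R}^N_+)$ with respect to the norm $$\|u\|_{\mathcal{D}^{1,p}_\gamma(\mathbb{R}^N_+)}=\left(\int_{\mathbb{R}^N_+}(1+x_N)^\gamma|\nabla u|^p\,dx+\int_{\mathbb{R}^N_+}\frac{|u|^p}{(1+x_N)^{p-\gamma}}\,dx\right)^{1/p}.$$ *)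

theory Defs
  imports "HOL-Analysis.Analysis"
begin

(* Points of R^N, N = CARD('m) + 1, are pairs x = (x', x_N), so that snd x is x_N. *)
type_synonym 'm pt = "(real^'m) \<times> real"

definition upper_half_space :: "'m::finite pt set" where
  "upper_half_space = {x. 0 < snd x}"

definition grad :: "('a::real_inner \<Rightarrow> real) \<Rightarrow> 'a \<Rightarrow> 'a" where
  "grad f x = (THE d. GDERIV f x :> d)"

primrec Ck :: "nat \<Rightarrow> ('a::euclidean_space \<Rightarrow> real) \<Rightarrow> bool" where
  "Ck 0 f \<longleftrightarrow> continuous_on UNIV f"
| "Ck (Suc k) f \<longleftrightarrow> (\<forall>x. f differentiable (at x)) \<and>
     (\<forall>v. Ck k (\<lambda>x. frechet_derivative f (at x) v))"

definition Cc_infty :: "('a::euclidean_space \<Rightarrow> real) set" where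
  "Cc_infty = {f. (\<forall>k. Ck k f) \<and> compact (closure {x. f x \<noteq> 0})}"

(* A function on the half-space is represented by a total function; its values off the
   half-space play no role, here and in everything below. *)
definition Cdelta_infty :: "('m::finite pt \<Rightarrow> real) set" where
  "Cdelta_infty = {v. \<exists>f\<in>Cc_infty. \<forall>x\<in>upper_half_space. v x = f x}"

(* The norm of D^{1,p}_gamma as a function of u and of its gradient g. *)
definition D_norm :: "real \<Rightarrow> real \<Rightarrow> ('m::finite pt \<Rightarrow> real) \<Rightarrow> ('m pt \<Rightarrow> 'm pt) \<Rightarrow> real" where
  "D_norm p \<gamma> u g =
     ((\<integral>x. (1 + snd x) powr \<gamma> * norm (g x) powr p \<partial>lebesgue_on upper_half_space) +
      (\<integral>x. \<bar>u x\<bar> powr p / (1 + snd x) powr (p - \<gamma>) \<partial>lebesgue_on upper_half_space)) powr (1 / p)"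

(* The completion of Cdelta_infty under this norm. The map v |-> (v, grad v) embeds
   Cdelta_infty isometrically into the product of the two weighted L^p spaces occurring in
   the norm; this product is complete, so the completion is the closure of the image. An element
   is thus a function u together with its gradient g, the L^p limit of the gradients of the
   approximating functions. As the weights are bounded above and below by positive constants on
   bounded sets, g is the weak gradient of u, and u determines g almost everywhere.
   The two integrability conditions make all integrals in D_norm below
   genuine: without them a Bochner integral could be 0 by default. *)
definition D_space ::
  "real \<Rightarrow> real \<Rightarrow> (('m::finite pt \<Rightarrow> real) \<times> ('m pt \<Rightarrow> 'm pt)) set" where
  "D_space p \<gamma> = {(u, g).
     u \<in> borel_measurable (lebesgue_on upper_half_space) \<and>
     g \<in> borel_measurable (lebesgue_on upper_half_space) \<and>
     integrable (lebesgue_on upper_half_space) (\<lambda>x. (1 + snd x) powr \<gamma> * norm (g x) powr p) \<and>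
     integrable (lebesgue_on upper_half_space) (\<lambda>x. \<bar>u x\<bar> powr p / (1 + snd x) powr (p - \<gamma>)) \<and>
     (\<exists>v. (\<forall>n. v n \<in> Cdelta_infty) \<and>
        (\<lambda>n. D_norm p \<gamma> (\<lambda>x. v n x - u x) (\<lambda>x. grad (v n) x - g x)) \<longlonglongrightarrow> 0)}"

end

(* For smooth u put v = |u|^s (1 + x_N)^beta with beta = (gamma - p)(N - 1)/N. Integrating along the
   rays parallel to the axes that stay in the half-space bounds v by the line integrals of |grad v|,
   and the Gagliardo-Nirenberg argument yields (int v^(N/(N-1)))^((N-1)/N) <= int |grad v|; by the
   choice of beta the left-hand integrand is |u|^(sN/(N-1)) (1 + x_N)^(gamma - p). Young's inequality
   bounds |grad v| by kappa |u|^r (1 + x_N)^(gamma - p), r = (s - 1) p/(p - 1), plus a multiple of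
   the two integrands of the norm, and Hardy's inequality in x_N removes the zeroth order one (this
   is where gamma > p - 1 enters). For p < N one takes r = sN/(N-1) = p* and absorbs the term with
   kappa; for p = N the same estimate raises the exponent from r to r + N/(N-1), starting at p.
   Exponents in between follow by interpolation, and Fatou's lemma passes to the completion. *)
theory Submission imports Defs begin

text \<open>No boundary condition is imposed at x_N = 0, so a point cannot be joined to infinity in
  both directions of a line. All rays point towards +b; basis vectors have \<open>snd b\<close>
  \<ge> 0, so each of the N rays stays in the half-space. In the Hardy step the boundary value has a
  favourable sign and is dropped. The split into p < N and p = N comes from one equation. The basic
  estimate turns a bound at exponent (s - 1) p/(p - 1) into one at s N/(N - 1). For p < N the two
  agree when s = p (N - 1)/(N - p); for p = N they differ by N/(N - 1) whatever s is, which leaves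
  iteration. The exponent estimates are made for energy at most 1. They may then be inhomogeneous,
  with additive constants, and scaling restores homogeneity afterwards. Integrals of test functions
  are taken in \<open>ennreal\<close>, so that integrability need not be carried along; absorption,
  however, requires the mass to be known finite beforehand.\<close>

section \<open>The Gagliardo inequality\<close>

text \<open>Hoelder's inequality for \<open>card J\<close> factors with equal exponents, with powers
  in place of roots. If all integrals are positive and finite, each \<open>g i\<close> is divided by
  its integral and the arithmetic-geometric mean inequality is integrated. A vanishing integral is
  dealt with before infinite ones, because 0 * top = 0 in \<open>ennreal\<close>.\<close>

lemma nn_integral_power_le_prod:
  fixes f :: "'a \<Rightarrow> ennreal" and g :: "'i \<Rightarrow> 'a \<Rightarrow> ennreal"
  assumes J: "finite J" "J \<noteq> {}"
    and [measurable]: "f \<in> borel_measurable M" "\<And>i. i \<in> J \<Longrightarrow> g i \<in> borel_measurable M"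
    and le: "\<And>x. x \<in> space M \<Longrightarrow> f x ^ card J \<le> (\<Prod>i\<in>J. g i x)"
  shows "(\<integral>\<^sup>+x. f x \<partial>M) ^ card J \<le> (\<Prod>i\<in>J. \<integral>\<^sup>+x. g i x \<partial>M)"
proof -
  let ?m = "card J" and ?G = "\<lambda>i. \<integral>\<^sup>+x. g i x \<partial>M"
  have m: "?m > 0" using J by (simp add: card_gt_0_iff)
  consider (zero) i where "i \<in> J" "?G i = 0" | (top) i where "i \<in> J" "?G i = top" "\<forall>j\<in>J. ?G j \<noteq> 0"
    | (fin) "\<forall>i\<in>J. ?G i \<noteq> 0 \<and> ?G i \<noteq> top" by blast
  then show ?thesis
  proof cases
    case zero
    then have "AE x in M. g i x = 0" by (simp add: nn_integral_0_iff_AE)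
    then have "AE x in M. f x = 0"
    proof (rule AE_mp[OF _ AE_I2], intro impI)
      fix x assume x: "x \<in> space M" "g i x = 0"
      then have "(\<Prod>i\<in>J. g i x) = 0" using zero(1) J by (metis prod_zero)
      with le[OF x(1)] have "f x ^ ?m = 0" by simp
      then show "f x = 0" using m by simp
    qed
    then have "(\<integral>\<^sup>+x. f x \<partial>M) = 0" by (simp add: nn_integral_0_iff_AE)
    then show ?thesis using m by (simp add: zero_power)
  next
    case top
    have "(\<Prod>j\<in>J - {i}. ?G j) \<noteq> 0" using top J by simp
    then have "(\<Prod>j\<in>J. ?G j) = top"
      using top by (subst prod.remove[OF J(1) top(1)]) (simp add: ennreal_top_mult)
    then show ?thesis by simp
  next
    case fin
    define a where "a = (\<lambda>i. enn2real (?G i))"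
    have aG: "?G i = ennreal (a i)" and a: "a i > 0" if "i \<in> J" for i
      using fin that by (auto simp: a_def enn2real_positive_iff less_top zero_less_iff_neq_zero)
    \<comment> \<open>\<open>c\<close> is the geometric mean of the integrals, so
      \<open>c ^ card J\<close> is the right-hand side; the majorant in \<open>pt\<close> has
      integral exactly \<open>c\<close>.\<close>
    define c where "c = root ?m (\<Prod>i\<in>J. a i)"
    have c0: "c \<ge> 0" unfolding c_def using a by (intro real_root_ge_zero prod_nonneg) (auto intro: less_imp_le)
    have cm: "c ^ ?m = (\<Prod>i\<in>J. a i)"
      unfolding c_def using a m by (intro real_root_pow_pos2 prod_nonneg) (auto intro: less_imp_le)
    have cpos: "c > 0" unfolding c_def using a m J by (intro real_root_gt_zero prod_pos) auto
    have pt: "f x \<le> ennreal c * (\<Sum>i\<in>J. g i x / ennreal (a i * ?m))" if x: "x \<in> space M" for x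
    proof (cases "\<exists>i\<in>J. g i x = top")
      case True
      then obtain i where i: "i \<in> J" "g i x = top" by blast
      then have "g i x / ennreal (a i * ?m) = top" by (simp add: ennreal_top_divide)
      then have "(\<Sum>i\<in>J. g i x / ennreal (a i * ?m)) = top"
        using i(1) J by (meson ennreal_sum_eq_top)
      then show ?thesis using cpos by (simp add: ennreal_mult_top)
    next
      case False
      define y where "y = (\<lambda>i. enn2real (g i x))"
      have gy: "g i x = ennreal (y i)" and y0: "y i \<ge> 0" if "i \<in> J" for i
        using False that by (auto simp: y_def less_top)
      have "f x ^ ?m \<le> ennreal (\<Prod>i\<in>J. y i)"
        using le[OF x] by (simp add: gy prod_ennreal y0 cong: prod.cong)
      then have "f x ^ ?m \<noteq> top" by (metis ennreal_less_top leD top.not_eq_extremum)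
      then have "f x \<noteq> top" using m by (auto simp: power_eq_top_ennreal)
      then obtain r where r: "f x = ennreal r" "r \<ge> 0" by (cases "f x") auto
      have "r ^ ?m \<le> (\<Prod>i\<in>J. y i)"
        using \<open>f x ^ ?m \<le> ennreal (\<Prod>i\<in>J. y i)\<close> r y0 by (simp add: ennreal_power prod_nonneg)
      then have "(r / c) ^ ?m \<le> (\<Prod>i\<in>J. y i / a i)"
        using a cpos by (simp add: power_divide cm prod_dividef divide_right_mono prod_nonneg less_imp_le)
      then have "r / c \<le> root ?m (\<Prod>i\<in>J. y i / a i)"
        using m r cpos by (metis divide_nonneg_pos real_root_le_iff real_root_power_cancel)
      also have "\<dots> \<le> (\<Sum>i\<in>J. y i / a i) / ?m"
        using arith_geom_mean[OF J, of "\<lambda>i. y i / a i"] y0 a m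
        by (simp add: root_powr_inverse prod_nonneg less_imp_le sum_divide_distrib)
      finally have "r \<le> c * ((\<Sum>i\<in>J. y i / a i) / ?m)" using cpos by (simp add: field_simps)
      also have "\<dots> = c * (\<Sum>i\<in>J. y i / (a i * ?m))" by (simp add: sum_divide_distrib)
      finally have "f x \<le> ennreal (c * (\<Sum>i\<in>J. y i / (a i * ?m)))" using r by (simp add: ennreal_leI)
      also have "\<dots> = ennreal c * (\<Sum>i\<in>J. g i x / ennreal (a i * ?m))"
      proof -
        have "g i x / ennreal (a i * ?m) = ennreal (y i / (a i * ?m))" if "i \<in> J" for i
          unfolding gy[OF that] using that y0 a m by (intro divide_ennreal) auto
        moreover have "y i / (a i * ?m) \<ge> 0" if "i \<in> J" for i
          using that y0[OF that] a[OF that] by simp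
        ultimately show ?thesis using c0 by (simp add: ennreal_mult sum_nonneg del: ennreal_mult' cong: sum.cong)
      qed
      finally show ?thesis .
    qed
    have "(\<integral>\<^sup>+x. f x \<partial>M) \<le> (\<integral>\<^sup>+x. ennreal c * (\<Sum>i\<in>J. g i x / ennreal (a i * ?m)) \<partial>M)"
      by (intro nn_integral_mono pt)
    also have "\<dots> = ennreal c * (\<Sum>i\<in>J. ?G i / ennreal (a i * ?m))"
      by (subst nn_integral_cmult, measurable, subst nn_integral_sum) (auto simp: nn_integral_divide cong: sum.cong)
    also have "(\<Sum>i\<in>J. ?G i / ennreal (a i * ?m)) = (\<Sum>i\<in>J. ennreal (1 / ?m))"
    proof (intro sum.cong refl)
      fix i assume "i \<in> J"
      then show "?G i / ennreal (a i * ?m) = ennreal (1 / ?m)"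
        using a[of i] m unfolding aG[OF \<open>i \<in> J\<close>] by (subst divide_ennreal) auto
    qed
    also have "\<dots> = 1" using m J by (subst sum_ennreal) auto
    finally have "(\<integral>\<^sup>+x. f x \<partial>M) ^ ?m \<le> ennreal c ^ ?m" by (intro power_mono_ennreal) simp
    also have "\<dots> = (\<Prod>i\<in>J. ?G i)" using c0 a by (simp add: ennreal_power cm aG prod_ennreal less_imp_le cong: prod.cong)
    finally show ?thesis .
  qed
qed

text \<open>The integral over the coordinate plane through \<open>x\<close> spanned by
  \<open>S\<close>. It runs from \<open>f x\<close> for empty \<open>S\<close> to the Lebesgue
  integral for \<open>S = Basis\<close>, which makes integration in one direction after the other an
  induction on \<open>S\<close>.\<close>

definition axis_integral :: "'a::euclidean_space set \<Rightarrow> ('a \<Rightarrow> ennreal) \<Rightarrow> 'a \<Rightarrow> ennreal" where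
  "axis_integral S f x = (\<integral>\<^sup>+y. f (x + (\<Sum>b\<in>S. y b *\<^sub>R b)) \<partial>(\<Pi>\<^sub>M b\<in>S. lborel))"

interpretation lborel_product: product_sigma_finite "\<lambda>_::'i. lborel :: real measure"
  by standard

lemma axis_integral_measurable [measurable]:
  fixes f :: "'a::euclidean_space \<Rightarrow> ennreal"
  assumes "finite S" and [measurable]: "f \<in> borel_measurable borel"
  shows "axis_integral S f \<in> borel_measurable borel"
proof -
  interpret finite_product_sigma_finite "\<lambda>_. lborel :: real measure" S
    by standard fact
  have "(\<lambda>x. axis_integral S f x) \<in> borel_measurable borel"
    unfolding axis_integral_def
    by (rule borel_measurable_nn_integral) measurable
  then show ?thesis by simp
qed

lemma axis_integral_empty [simp]: "axis_integral {} f x = f x"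
  by (simp add: axis_integral_def space_PiM_empty)

lemma axis_integral_insert:
  fixes f :: "'a::euclidean_space \<Rightarrow> ennreal"
  assumes S: "finite S" "c \<notin> S" and [measurable]: "f \<in> borel_measurable borel"
  shows "axis_integral (insert c S) f x = (\<integral>\<^sup>+t. axis_integral S f (x + t *\<^sub>R c) \<partial>lborel)"
proof -
  have *: "(\<Sum>b\<in>S. (y(c := t)) b *\<^sub>R b) = (\<Sum>b\<in>S. y b *\<^sub>R b)" for y :: "'a \<Rightarrow> real" and t
    using S by (intro sum.cong) auto
  have "axis_integral (insert c S) f x = (\<integral>\<^sup>+t. \<integral>\<^sup>+y. f (x + (\<Sum>b\<in>insert c S. (y(c := t)) b *\<^sub>R b))
      \<partial>(\<Pi>\<^sub>M b\<in>S. lborel) \<partial>lborel)"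
    unfolding axis_integral_def using S
    by (intro lborel_product.product_nn_integral_insert_rev) (auto, measurable)
  also have "\<dots> = (\<integral>\<^sup>+t. axis_integral S f (x + t *\<^sub>R c) \<partial>lborel)"
    unfolding axis_integral_def using S by (simp add: * add.assoc del: fun_upd_apply) (simp add: *)
  finally show ?thesis .
qed

text \<open>Translation invariance of Lebesgue measure along \<open>c\<close>. It lets the factor
  belonging to direction \<open>c\<close> leave the integral in that direction.\<close>

lemma axis_integral_shift:
  fixes f :: "'a::euclidean_space \<Rightarrow> ennreal"
  assumes S: "finite S" "c \<in> S" and [measurable]: "f \<in> borel_measurable borel"
  shows "axis_integral S f (x + t *\<^sub>R c) = axis_integral S f x"
proof -
  let ?T = "S - {c}"
  have e: "S = insert c ?T" using S by blast
  have "axis_integral S f (x + t *\<^sub>R c) = (\<integral>\<^sup>+s. axis_integral ?T f (x + (t + s) *\<^sub>R c) \<partial>lborel)"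
    by (subst e, subst axis_integral_insert) (use S in \<open>auto simp: algebra_simps\<close>)
  also have "\<dots> = (\<integral>\<^sup>+s. axis_integral ?T f (x + s *\<^sub>R c) \<partial>lborel)"
    using S nn_integral_real_affine[of "\<lambda>s. axis_integral ?T f (x + s *\<^sub>R c)" 1 t] by simp
  also have "\<dots> = axis_integral S f x"
    by (subst (2) e, subst axis_integral_insert) (use S in auto)
  finally show ?thesis .
qed

lemma axis_integral_Basis:
  fixes f :: "'a::euclidean_space \<Rightarrow> ennreal"
  assumes [measurable]: "f \<in> borel_measurable borel"
  shows "axis_integral Basis f 0 = (\<integral>\<^sup>+x. f x \<partial>lborel)"
  by (subst lborel_eq) (simp add: axis_integral_def nn_integral_distr)

text \<open>One integrates in one direction after the other. In the direction \<open>c\<close> the factor belonging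
  to \<open>c\<close> is constant, and Hoelder's inequality applies to the remaining \<open>DIM('a) - 1\<close> factors.\<close>

lemma axis_integral_power_le:
  fixes h :: "'a::euclidean_space \<Rightarrow> ennreal" and f :: "'a \<Rightarrow> 'a \<Rightarrow> ennreal"
  assumes dim: "DIM('a) \<ge> 2" and S: "finite S" "S \<subseteq> Basis"
    and [measurable]: "h \<in> borel_measurable borel" "\<And>b. b \<in> Basis \<Longrightarrow> f b \<in> borel_measurable borel"
    and le: "\<And>x. h x ^ (DIM('a) - 1) \<le> (\<Prod>b\<in>Basis. \<integral>\<^sup>+t. f b (x + t *\<^sub>R b) \<partial>lborel)"
  shows "axis_integral S h x ^ (DIM('a) - 1) \<le> (\<Prod>b\<in>Basis. axis_integral (insert b S) (f b) x)"
  using S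
proof (induction S arbitrary: x rule: finite_induct)
  case empty
  then show ?case using le by (simp add: axis_integral_insert)
next
  case (insert c S)
  let ?J = "Basis - {c}" and ?I = axis_integral
  have c: "c \<in> Basis" and [simp]: "finite S" and SB: "S \<subseteq> Basis" using insert by auto
  have cJ: "card ?J = DIM('a) - 1" using c by simp
  have "card ?J > 0" unfolding cJ using dim by simp
  then have J: "finite ?J" "?J \<noteq> {}" by (simp_all add: card_gt_0_iff)
  \<comment> \<open>The constant factor is hidden in the factor of one arbitrary direction
    \<open>d\<close>, so that Hoelder's inequality sees exactly DIM - 1 factors. Such a
    \<open>d\<close> exists as the dimension is at least 2.\<close>
  obtain d where d: "d \<in> ?J" using J by blast
  let ?g = "\<lambda>b t. (if b = d then ?I (insert c S) (f c) x else 1) * ?I (insert b S) (f b) (x + t *\<^sub>R c)"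
  have "(\<integral>\<^sup>+t. ?I S h (x + t *\<^sub>R c) \<partial>lborel) ^ card ?J \<le> (\<Prod>b\<in>?J. \<integral>\<^sup>+t. ?g b t \<partial>lborel)"
  proof (rule nn_integral_power_le_prod[OF J])
    fix t :: real
    have "?I S h (x + t *\<^sub>R c) ^ card ?J \<le> (\<Prod>b\<in>Basis. ?I (insert b S) (f b) (x + t *\<^sub>R c))"
      unfolding cJ by (rule insert.IH[OF SB])
    also have "\<dots> = ?I (insert c S) (f c) x * (\<Prod>b\<in>?J. ?I (insert b S) (f b) (x + t *\<^sub>R c))"
      using c by (subst prod.remove[OF _ c]) (simp_all add: axis_integral_shift)
    also have "\<dots> = (\<Prod>b\<in>?J. ?g b t)"
      using d by (simp add: prod.distrib prod.delta)
    finally show "?I S h (x + t *\<^sub>R c) ^ card ?J \<le> (\<Prod>b\<in>?J. ?g b t)" .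
  qed measurable
  also have "(\<integral>\<^sup>+t. ?I S h (x + t *\<^sub>R c) \<partial>lborel) = ?I (insert c S) h x"
    using insert by (simp add: axis_integral_insert)
  also have "(\<Prod>b\<in>?J. \<integral>\<^sup>+t. ?g b t \<partial>lborel)
     = (\<Prod>b\<in>?J. (if b = d then ?I (insert c S) (f c) x else 1) * (\<integral>\<^sup>+t. ?I (insert b S) (f b) (x + t *\<^sub>R c) \<partial>lborel))"
    by (intro prod.cong refl nn_integral_cmult) measurable
  also have "\<dots> = ?I (insert c S) (f c) x * (\<Prod>b\<in>?J. \<integral>\<^sup>+t. ?I (insert b S) (f b) (x + t *\<^sub>R c) \<partial>lborel)"
    using d by (simp add: prod.distrib prod.delta)
  also have "(\<Prod>b\<in>?J. \<integral>\<^sup>+t. ?I (insert b S) (f b) (x + t *\<^sub>R c) \<partial>lborel) = (\<Prod>b\<in>?J. ?I (insert b (insert c S)) (f b) x)"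
    using insert by (intro prod.cong refl) (auto simp: insert_commute[of _ c] axis_integral_insert)
  also have "?I (insert c S) (f c) x * \<dots> = (\<Prod>b\<in>Basis. ?I (insert b (insert c S)) (f b) x)"
    using prod.remove[OF finite_Basis c, of "\<lambda>b. ?I (insert b (insert c S)) (f b) x"] by simp
  finally show ?case unfolding cJ .
qed

text \<open>Of Loomis-Whitney type: the factor for \<open>b\<close> is a line integral and thus
  independent of the coordinate of \<open>x\<close> along \<open>b\<close>. It is the end
  \<open>S = Basis\<close> of the induction, where every \<open>insert b S\<close> is
  \<open>Basis\<close>.\<close>

proposition Gagliardo_nn_integral:
  fixes h :: "'a::euclidean_space \<Rightarrow> ennreal" and f :: "'a \<Rightarrow> 'a \<Rightarrow> ennreal"
  assumes "DIM('a) \<ge> 2"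
    and "h \<in> borel_measurable borel" "\<And>b. b \<in> Basis \<Longrightarrow> f b \<in> borel_measurable borel"
    and "\<And>x. h x ^ (DIM('a) - 1) \<le> (\<Prod>b\<in>Basis. \<integral>\<^sup>+t. f b (x + t *\<^sub>R b) \<partial>lborel)"
  shows "(\<integral>\<^sup>+x. h x \<partial>lborel) ^ (DIM('a) - 1) \<le> (\<Prod>b\<in>Basis. \<integral>\<^sup>+x. f b x \<partial>lborel)"
  using axis_integral_power_le[OF assms(1) finite_Basis order_refl assms(2-4), of 0]
  by (simp add: axis_integral_Basis assms(2,3) insert_absorb cong: prod.cong)

section \<open>Functions of class C1 with compact support\<close>

text \<open>\<open>grad\<close> is a definite description; the first clause guarantees that it is a
  true gradient. Vanishing outside a ball is the form of compact support that integration along rays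
  uses.\<close>

definition C1_compact_support :: "('a::euclidean_space \<Rightarrow> real) \<Rightarrow> bool" where
  "C1_compact_support f \<longleftrightarrow>
     (\<forall>x. (f has_derivative (\<lambda>h. h \<bullet> grad f x)) (at x)) \<and>
     continuous_on UNIV (grad f) \<and> (\<exists>R>0. \<forall>x. R \<le> norm x \<longrightarrow> f x = 0)"

lemma grad_eqI:
  assumes "(f has_derivative (\<lambda>h. h \<bullet> d)) (at x)"
  shows "grad f x = d"
  unfolding grad_def gderiv_def
proof (rule the_equality)
  show "(f has_derivative (\<lambda>h. h \<bullet> d)) (at x)" by fact
  fix e assume "(f has_derivative (\<lambda>h. h \<bullet> e)) (at x)"
  then have "(\<lambda>h. h \<bullet> e) = (\<lambda>h. h \<bullet> d)" by (rule has_derivative_unique[OF _ assms])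
  then have "h \<bullet> e = h \<bullet> d" for h by (rule fun_cong)
  then show "e = d" by (rule vector_eq_ldot[THEN iffD1, OF allI])
qed

lemma grad_cong_open:
  assumes "open S" "x \<in> S" "\<And>y. y \<in> S \<Longrightarrow> f y = g y"
  shows "grad f x = grad g x"
proof -
  have "(f has_derivative D) (at x) \<longleftrightarrow> (g has_derivative D) (at x)" for D
  proof
    assume "(f has_derivative D) (at x)"
    then show "(g has_derivative D) (at x)"
      by (rule has_derivative_transform_within_open[OF _ assms])
  next
    assume "(g has_derivative D) (at x)"
    then show "(f has_derivative D) (at x)"
      by (rule has_derivative_transform_within_open[OF _ assms(1,2)]) (rule assms(3)[symmetric])
  qed
  then show ?thesis by (simp add: grad_def gderiv_def)
qed

text \<open>\<open>Ck\<close> speaks of derivatives in fixed directions; the gradient is assembled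
  from those along the basis and inherits their continuity.\<close>

lemma Cc_infty_imp_C1_compact_support:
  assumes "f \<in> Cc_infty"
  shows "C1_compact_support f"
proof -
  have "Ck (Suc 0) f" and cpt: "compact (closure {x. f x \<noteq> 0})"
    using assms by (simp_all add: Cc_infty_def del: Ck.simps)
  then have diff: "f differentiable (at x)"
    and cont: "continuous_on UNIV (\<lambda>x. frechet_derivative f (at x) v)" for x v
    unfolding Ck.simps by blast+
  let ?g = "\<lambda>x. \<Sum>b\<in>Basis. frechet_derivative f (at x) b *\<^sub>R b"
  have eq: "frechet_derivative f (at x) h = h \<bullet> ?g x" for x h
  proof -
    have lin: "linear (frechet_derivative f (at x))"
      using linear_frechet_derivative[OF diff] .
    have "frechet_derivative f (at x) (\<Sum>b\<in>Basis. (h \<bullet> b) *\<^sub>R b) = (\<Sum>b\<in>Basis. (h \<bullet> b) * frechet_derivative f (at x) b)"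
      by (simp only: linear_sum[OF lin] linear_cmul[OF lin] real_scaleR_def)
    then show ?thesis by (simp only: euclidean_representation inner_sum_right inner_scaleR_right mult.commute)
  qed
  have der: "(f has_derivative (\<lambda>h. h \<bullet> ?g x)) (at x)" for x
  proof -
    have "(f has_derivative frechet_derivative f (at x)) (at x)"
      using diff[of x] unfolding frechet_derivative_works .
    then show ?thesis
      by (rule back_subst[where P = "\<lambda>D. (f has_derivative D) (at x)"]) (rule ext, rule eq)
  qed
  have g: "grad f = ?g" by (rule ext) (rule grad_eqI[OF der])
  obtain R where R: "\<And>x. x \<in> closure {x. f x \<noteq> 0} \<Longrightarrow> norm x \<le> R"
    using compact_imp_bounded[OF cpt] unfolding bounded_iff by blast
  \<comment> \<open>\<open>R\<close> may be negative and its bound is not strict, hence the radius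
    \<open>\<bar>R\<bar> + 1\<close>.\<close>
  have "f x = 0" if "\<bar>R\<bar> + 1 \<le> norm x" for x
  proof (rule ccontr)
    assume "f x \<noteq> 0"
    then have "x \<in> closure {x. f x \<noteq> 0}"
      by (intro subsetD[OF closure_subset]) simp
    with R[of x] that show False by linarith
  qed
  then have "\<exists>R>0. \<forall>x. R \<le> norm x \<longrightarrow> f x = 0" by (intro exI[of _ "\<bar>R\<bar> + 1"]) auto
  moreover have "continuous_on UNIV (grad f)"
    unfolding g by (intro continuous_intros cont)
  moreover have "(f has_derivative (\<lambda>h. h \<bullet> grad f x)) (at x)" for x
    unfolding grad_eqI[OF der] by (rule der)
  ultimately show ?thesis unfolding C1_compact_support_def by blast
qed

lemma C1_compact_support_continuous:
  assumes "C1_compact_support f"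
  shows "continuous_on S f"
proof (rule continuous_at_imp_continuous_on, rule ballI)
  fix x
  have "(f has_derivative (\<lambda>h. h \<bullet> grad f x)) (at x)"
    using assms unfolding C1_compact_support_def by blast
  then show "continuous (at x) f" by (rule has_derivative_continuous)
qed

lemma C1_compact_support_continuous_grad:
  "C1_compact_support f \<Longrightarrow> continuous_on S (grad f)"
  unfolding C1_compact_support_def by (elim conjE) (rule continuous_on_subset, auto)

lemma has_derivative_mult_grad:
  assumes "C1_compact_support f"
  shows "((\<lambda>x. c * f x) has_derivative (\<lambda>h. h \<bullet> c *\<^sub>R grad f x)) (at x)"
proof -
  have "(f has_derivative (\<lambda>h. h \<bullet> grad f x)) (at x)"
    using assms unfolding C1_compact_support_def by blast
  from has_derivative_mult_right[OF this, of c] show ?thesis by simp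
qed

lemmas grad_mult = grad_eqI[OF has_derivative_mult_grad]

lemma C1_compact_support_mult:
  assumes "C1_compact_support f"
  shows "C1_compact_support (\<lambda>x. c * f x)"
proof -
  note has_derivative_mult_grad[OF assms, of c]
  moreover have "continuous_on UNIV (\<lambda>x. c *\<^sub>R grad f x)"
    using assms by (intro continuous_intros C1_compact_support_continuous_grad)
  moreover obtain R where "R > 0" "\<And>x. R \<le> norm x \<Longrightarrow> f x = 0"
    using assms unfolding C1_compact_support_def by blast
  then have "\<exists>R>0. \<forall>x. R \<le> norm x \<longrightarrow> c * f x = 0" by (intro exI[of _ R] conjI allI impI) simp_all
  ultimately show ?thesis
    unfolding C1_compact_support_def grad_mult[OF assms, abs_def] by blast
qed

section \<open>Derivatives along lines and scalar inequalities\<close>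

lemma has_real_derivative_abs_powr:
  fixes t s :: real
  assumes "s > 1"
  shows "((\<lambda>t. \<bar>t\<bar> powr s) has_real_derivative s * \<bar>t\<bar> powr (s - 1) * sgn t) (at t)"
proof -
  consider "t > 0" | "t < 0" | "t = 0" by linarith
  then show ?thesis
  proof cases
    case 1
    then have "((\<lambda>t. t powr s) has_real_derivative s * \<bar>t\<bar> powr (s - 1) * sgn t) (at t)"
      by (auto intro!: derivative_eq_intros)
    then show ?thesis
      by (rule has_field_derivative_transform_within_open[of _ _ _ "{0<..}"]) (use 1 in auto)
  next
    case 2
    then have "((\<lambda>t. (-t) powr s) has_real_derivative s * \<bar>t\<bar> powr (s - 1) * sgn t) (at t)"
      by (auto intro!: derivative_eq_intros)
    then show ?thesis
      by (rule has_field_derivative_transform_within_open[of _ _ _ "{..<0}"]) (use 2 in auto)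
  next
    \<comment> \<open>At 0 the formula gives the derivative 0, since \<open>sgn 0 = 0\<close>. The
      difference quotient has modulus |h|^(s - 1), which tends to 0 because s > 1.\<close>
    case 3
    have "((\<lambda>h. \<bar>h\<bar> powr (s - 1)) \<longlongrightarrow> 0) (at (0::real))"
      using assms by (auto intro!: tendsto_eq_intros)
    then have "((\<lambda>h. \<bar>h\<bar> powr s / h) \<longlongrightarrow> 0) (at (0::real))"
    proof (rule Lim_null_comparison[rotated])
      show "\<forall>\<^sub>F h in at 0. norm (\<bar>h\<bar> powr s / h) \<le> \<bar>h\<bar> powr (s - 1)"
        unfolding eventually_at by (auto intro!: exI[of _ 1] simp: powr_diff)
    qed
    then show ?thesis using 3 by (simp add: DERIV_def)
  qed
qed

text \<open>Used twice: along every axis with the exponents s and \<beta> of the Gagliardo-Nirenberg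
  step, and along x_N with the exponents p and \<gamma> - p + 1 for Hardy's inequality.\<close>

lemma abs_powr_mult_powr_has_derivative:
  fixes f :: "'m::finite pt \<Rightarrow> real"
  assumes f: "C1_compact_support f" and s: "s > 1" and pos: "0 < 1 + snd (x + t *\<^sub>R b)"
  defines "y \<equiv> x + t *\<^sub>R b"
  shows "((\<lambda>t. \<bar>f (x + t *\<^sub>R b)\<bar> powr s * (1 + snd (x + t *\<^sub>R b)) powr \<beta>) has_real_derivative
     s * \<bar>f y\<bar> powr (s - 1) * sgn (f y) * (b \<bullet> grad f y) * (1 + snd y) powr \<beta>
     + \<bar>f y\<bar> powr s * (\<beta> * (1 + snd y) powr (\<beta> - 1) * snd b)) (at t)"
proof -
  have "(f has_derivative (\<lambda>h. h \<bullet> grad f y)) (at y)"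
    using f unfolding C1_compact_support_def by blast
  moreover have "((\<lambda>t. x + t *\<^sub>R b) has_derivative (\<lambda>h. h *\<^sub>R b)) (at t)"
    by (auto intro!: derivative_eq_intros)
  ultimately have "((\<lambda>t. f (x + t *\<^sub>R b)) has_derivative (\<lambda>h. (h *\<^sub>R b) \<bullet> grad f y)) (at t)"
    using has_derivative_compose unfolding y_def by blast
  then have "((\<lambda>t. f (x + t *\<^sub>R b)) has_real_derivative b \<bullet> grad f y) (at t)"
    by (simp add: has_field_derivative_def mult_commute_abs)
  then have 1: "((\<lambda>t. \<bar>f (x + t *\<^sub>R b)\<bar> powr s) has_real_derivative
      (s * \<bar>f y\<bar> powr (s - 1) * sgn (f y)) * (b \<bullet> grad f y)) (at t)"
    unfolding y_def by (rule DERIV_chain2[OF has_real_derivative_abs_powr[OF s]])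
  have 2: "((\<lambda>t. (1 + snd (x + t *\<^sub>R b)) powr \<beta>) has_real_derivative
     \<beta> * (1 + snd y) powr (\<beta> - 1) * snd b) (at t)"
  proof -
    have "((\<lambda>t. 1 + snd (x + t *\<^sub>R b)) has_real_derivative snd b) (at t)"
      by (auto intro!: derivative_eq_intros)
    then show ?thesis unfolding y_def
      by (rule DERIV_chain2[where g = "\<lambda>t. 1 + snd (x + t *\<^sub>R b)", OF has_real_derivative_powr[OF pos, of \<beta>]])
  qed
  show ?thesis using DERIV_mult[OF 1 2] unfolding y_def by (simp add: mult_ac add_ac)
qed

text \<open>A one-sided fundamental theorem. With F = 0 it bounds the initial value
  \<open>v 0\<close> by an integral along a ray; with a nontrivial F the term \<open>v 0\<close> is
  discarded and a one-dimensional Hardy inequality remains.\<close>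

lemma FTC_nn_integral_le:
  fixes v v' F A :: "real \<Rightarrow> real"
  assumes T: "0 \<le> T"
    and der: "\<And>t. t \<in> {0..T} \<Longrightarrow> (v has_real_derivative v' t) (at t)"
    and v: "v T = 0" "0 \<le> v 0"
    and cont: "continuous_on {0..T} F" "continuous_on {0..T} A"
    and nonneg: "\<And>t. t \<in> {0..T} \<Longrightarrow> 0 \<le> F t" "\<And>t. t \<in> {0..T} \<Longrightarrow> 0 \<le> A t"
    and le: "\<And>t. t \<in> {0..T} \<Longrightarrow> F t - A t \<le> v' t"
  shows "ennreal (v 0) + (\<integral>\<^sup>+t\<in>{0..T}. F t \<partial>lborel) \<le> (\<integral>\<^sup>+t\<in>{0..T}. A t \<partial>lborel)"
proof -
  have nn: "(\<integral>\<^sup>+t\<in>{0..T}. G t \<partial>lborel) = ennreal (integral {0..T} G)"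
    if "continuous_on {0..T} G" "\<And>t. t \<in> {0..T} \<Longrightarrow> 0 \<le> G t" for G :: "real \<Rightarrow> real"
  proof -
    have int: "set_integrable lborel {0..T} G" by (rule borel_integrable_atLeastAtMost'[OF that(1)])
    have "(\<integral>\<^sup>+t\<in>{0..T}. G t \<partial>lborel) = (\<integral>\<^sup>+t. ennreal (indicat_real {0..T} t *\<^sub>R G t) \<partial>lborel)"
      by (intro nn_integral_cong) (simp split: split_indicator)
    also have "\<dots> = ennreal (integral {0..T} G)"
      using int that(2) set_borel_integral_eq_integral(2)[OF int]
      unfolding set_integrable_def set_lebesgue_integral_def
      by (subst nn_integral_eq_integral) (auto split: split_indicator)
    finally show ?thesis .
  qed
  have "(v' has_integral v T - v 0) {0..T}"
    using T der by (intro fundamental_theorem_of_calculus)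
      (auto simp: has_real_derivative_iff_has_vector_derivative[symmetric] intro: has_field_derivative_at_within)
  moreover have "((\<lambda>t. F t - A t) has_integral integral {0..T} F - integral {0..T} A) {0..T}"
    using cont by (intro has_integral_diff integrable_integral integrable_continuous_interval)
  ultimately have "integral {0..T} F - integral {0..T} A \<le> v T - v 0"
    using has_integral_le le by blast
  then have "v 0 + integral {0..T} F \<le> integral {0..T} A" using v by simp
  moreover have "0 \<le> integral {0..T} F" using nonneg cont
    by (intro integral_nonneg integrable_continuous_interval) auto
  ultimately show ?thesis
    using v nn[OF cont(1) nonneg(1)] nn[OF cont(2) nonneg(2)] 
    by (simp add: ennreal_leI flip: ennreal_plus)
qed

text \<open>Young's inequality with a free parameter and crude constants: for b \<le> \<kappa> a the
  first term alone suffices, otherwise a < b/\<kappa> and the second one does.\<close>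

lemma powr_mult_le:
  fixes a b \<kappa> p :: real
  assumes "0 \<le> a" "0 \<le> b" "0 < \<kappa>" "1 < p"
  shows "a powr (p - 1) * b \<le> \<kappa> * a powr p + \<kappa> powr (1 - p) * b powr p"
proof -
  have pow: "c powr (p - 1) * c = c powr p" if "c \<ge> 0" for c
    using that assms powr_mult_base[of c "p - 1"] by (simp add: mult.commute)
  show ?thesis
  proof (cases "b \<le> \<kappa> * a")
    case True
    then have "a powr (p - 1) * b \<le> a powr (p - 1) * (\<kappa> * a)" by (intro mult_left_mono) auto
    also have "\<dots> = \<kappa> * a powr p" using pow[OF assms(1)] by (metis mult.left_commute)
    finally show ?thesis by (smt (verit) mult_nonneg_nonneg powr_ge_zero)
  next
    case False
    then have "a \<le> b / \<kappa>" using assms by (simp add: field_simps)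
    then have "a powr (p - 1) * b \<le> (b / \<kappa>) powr (p - 1) * b"
      using assms by (intro mult_right_mono powr_mono2) auto
    also have "\<dots> = \<kappa> powr (1 - p) * b powr p"
      using pow[OF assms(2)] assms powr_minus_divide[of \<kappa> "p - 1"] by (simp add: powr_divide)
    finally show ?thesis using assms by (smt (verit) mult_nonneg_nonneg powr_ge_zero)
  qed
qed

lemma add_powr_le:
  fixes a b p :: real
  assumes "0 \<le> a" "0 \<le> b" "0 \<le> p"
  shows "(a + b) powr p \<le> 2 powr p * (a powr p + b powr p)"
proof -
  have "(a + b) powr p \<le> (2 * max a b) powr p" using assms by (intro powr_mono2) auto
  also have "\<dots> = 2 powr p * max (a powr p) (b powr p)"
    using assms powr_mono2[of p a b] powr_mono2[of p b a] by (auto simp: powr_mult max_def)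
  also have "\<dots> \<le> 2 powr p * (a powr p + b powr p)" by (intro mult_left_mono) auto
  finally show ?thesis .
qed

section \<open>Weighted inequalities on the half-space\<close>

definition weighted_mass :: "real \<Rightarrow> real \<Rightarrow> ('m::finite pt \<Rightarrow> real) \<Rightarrow> ennreal" where
  "weighted_mass r e f = (\<integral>\<^sup>+x\<in>upper_half_space. ennreal (\<bar>f x\<bar> powr r * (1 + snd x) powr e) \<partial>lborel)"

definition weighted_energy :: "real \<Rightarrow> real \<Rightarrow> ('m::finite pt \<Rightarrow> 'm pt) \<Rightarrow> ennreal" where
  "weighted_energy p \<gamma> g = (\<integral>\<^sup>+x\<in>upper_half_space. ennreal ((1 + snd x) powr \<gamma> * norm (g x) powr p) \<partial>lborel)"

lemma upper_half_space_borel [measurable]: "upper_half_space \<in> sets borel"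
proof -
  have "open (upper_half_space :: 'a pt set)"
    unfolding upper_half_space_def by (intro open_Collect_less continuous_intros)
  then show "(upper_half_space :: 'a pt set) \<in> sets borel" by simp
qed

lemma measurable_snd_borel [measurable]: "snd \<in> borel_measurable (borel :: 'm::finite pt measure)"
  by (intro borel_measurable_continuous_onI continuous_intros)

lemma C1_compact_support_measurable:
  assumes "C1_compact_support f"
  shows "f \<in> borel_measurable borel" "grad f \<in> borel_measurable borel"
  using assms
  by (simp_all add: borel_measurable_continuous_onI C1_compact_support_continuous C1_compact_support_continuous_grad)

lemma Basis_pt_snd:
  fixes b :: "'m::finite pt"
  assumes "b \<in> Basis"
  shows "0 \<le> snd b" "snd b \<le> 1" "norm b = 1"
  using assms by (auto simp: Basis_prod_def)

text \<open>A majorant of the derivative of |f|^s (1 + x_N)^\<beta> in every coordinate direction.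
  The power |f|^(s - 1) stands apart from the bracket because Young's inequality will separate the
  two.\<close>

definition power_gradient_bound :: "real \<Rightarrow> real \<Rightarrow> ('m::finite pt \<Rightarrow> real) \<Rightarrow> 'm pt \<Rightarrow> real" where
  "power_gradient_bound s \<beta> f x =
     \<bar>f x\<bar> powr (s - 1) * (1 + snd x) powr \<beta> * (s * norm (grad f x) + \<bar>\<beta>\<bar> * \<bar>f x\<bar> / (1 + snd x))"

text \<open>The ray from \<open>x\<close> along \<open>b\<close> moves parallel to the boundary or
  away from it and finally leaves the support, so the fundamental theorem has no term at the far
  end. Extending the ray to the part of its line in the half-space can only increase the integral
  and gives the form required by Gagliardo's inequality.\<close>

lemma abs_powr_mult_powr_le_ray_integral:
  fixes f :: "'m::finite pt \<Rightarrow> real"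
  assumes f: "C1_compact_support f" and s: "1 < s" and x: "x \<in> upper_half_space" and b: "b \<in> Basis"
  shows "ennreal (\<bar>f x\<bar> powr s * (1 + snd x) powr \<beta>)
    \<le> (\<integral>\<^sup>+t. ennreal (power_gradient_bound s \<beta> f (x + t *\<^sub>R b)) * indicator upper_half_space (x + t *\<^sub>R b) \<partial>lborel)"
proof -
  obtain R where R: "R > 0" "\<And>y. R \<le> norm y \<Longrightarrow> f y = 0"
    using f unfolding C1_compact_support_def by blast
  \<comment> \<open>By then the ray has left the ball of radius \<open>R\<close>: |x + T b| \<ge> T
    - |x| = R.\<close>
  define T where "T = norm x + R"
  let ?y = "\<lambda>t. x + t *\<^sub>R b"
  let ?G = "\<lambda>t. power_gradient_bound s \<beta> f (?y t)"
  define v where "v = (\<lambda>t. \<bar>f (?y t)\<bar> powr s * (1 + snd (?y t)) powr \<beta>)"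
  define v' where "v' = (\<lambda>t. s * \<bar>f (?y t)\<bar> powr (s - 1) * sgn (f (?y t)) * (b \<bullet> grad f (?y t)) * (1 + snd (?y t)) powr \<beta>
     + \<bar>f (?y t)\<bar> powr s * (\<beta> * (1 + snd (?y t)) powr (\<beta> - 1) * snd b))"
  have T: "T \<ge> 0" unfolding T_def using R by simp
  have pos: "0 < snd (?y t)" if "0 \<le> t" for t
    using x Basis_pt_snd[OF b] that unfolding upper_half_space_def by (simp add: add_pos_nonneg)
  have G0: "0 \<le> ?G t" if "0 \<le> t" for t
    using pos[OF that] s unfolding power_gradient_bound_def by (intro mult_nonneg_nonneg add_nonneg_nonneg) auto
  have "ennreal (v 0) + (\<integral>\<^sup>+t\<in>{0..T}. ennreal 0 \<partial>lborel) \<le> (\<integral>\<^sup>+t\<in>{0..T}. ennreal (?G t) \<partial>lborel)"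
  proof (rule FTC_nn_integral_le[OF T, of v v' "\<lambda>_. 0" ?G])
    show "(v has_real_derivative v' t) (at t)" if "t \<in> {0..T}" for t
      unfolding v_def v'_def using pos[of t] that
      by (intro abs_powr_mult_powr_has_derivative f s) auto
    have "norm (?y T) \<ge> norm (T *\<^sub>R b) - norm x"
      by (metis add.commute norm_diff_ineq)
    then have "norm (?y T) \<ge> R" using Basis_pt_snd(3)[OF b] T unfolding T_def by simp
    then show "v T = 0" unfolding v_def using R(2) by simp
    show "0 \<le> v 0" unfolding v_def by simp
    show "continuous_on {0..T} ?G"
    proof -
      have cy: "continuous_on {0..T} ?y" by (intro continuous_intros)
      have cf: "continuous_on {0..T} (\<lambda>t. f (?y t))"
        by (rule continuous_on_compose2[OF C1_compact_support_continuous[OF f, of UNIV] cy]) simp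
      have cg: "continuous_on {0..T} (\<lambda>t. grad f (?y t))"
        by (rule continuous_on_compose2[OF C1_compact_support_continuous_grad[OF f, of UNIV] cy]) simp
      have w: "\<forall>t\<in>{0..T}. 0 < 1 + snd (?y t)" using pos by (simp add: add_pos_pos)
      have "continuous_on {0..T} (\<lambda>t. \<bar>f (?y t)\<bar> powr (s - 1))"
        by (intro continuous_on_powr' continuous_intros cf) (use s in auto)
      moreover have "continuous_on {0..T} (\<lambda>t. (1 + snd (?y t)) powr \<beta>)"
        by (intro continuous_on_powr' continuous_intros) (use w in fastforce)
      moreover have "continuous_on {0..T} (\<lambda>t. s * norm (grad f (?y t)) + \<bar>\<beta>\<bar> * \<bar>f (?y t)\<bar> / (1 + snd (?y t)))"
        by (intro continuous_intros cf cg) (use w in fastforce)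
      ultimately show ?thesis unfolding power_gradient_bound_def by (intro continuous_on_mult)
    qed
    show "0 \<le> ?G t" if "t \<in> {0..T}" for t using G0 that by simp
    show "0 - ?G t \<le> v' t" if t: "t \<in> {0..T}" for t
    proof -
      let ?F = "\<bar>f (?y t)\<bar>" and ?w = "1 + snd (?y t)"
      have w: "?w > 0" using pos[of t] t by simp
      have sb: "\<bar>snd b\<bar> \<le> 1" using Basis_pt_snd[OF b] by simp
      have "\<bar>s * ?F powr (s - 1) * sgn (f (?y t)) * (b \<bullet> grad f (?y t)) * ?w powr \<beta>\<bar>
          = s * ?F powr (s - 1) * \<bar>sgn (f (?y t))\<bar> * \<bar>b \<bullet> grad f (?y t)\<bar> * ?w powr \<beta>"
        using s by (simp add: abs_mult)
      also have "\<dots> \<le> s * ?F powr (s - 1) * 1 * norm (grad f (?y t)) * ?w powr \<beta>"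
        using s Cauchy_Schwarz_ineq2[of b "grad f (?y t)"] Basis_pt_snd(3)[OF b]
        by (intro mult_mono order_refl mult_nonneg_nonneg) (auto simp: sgn_if)
      finally have 1: "\<bar>s * ?F powr (s - 1) * sgn (f (?y t)) * (b \<bullet> grad f (?y t)) * ?w powr \<beta>\<bar>
          \<le> s * ?F powr (s - 1) * norm (grad f (?y t)) * ?w powr \<beta>" by simp
      have Fs: "?F powr s = ?F powr (s - 1) * ?F"
        using s powr_mult_base[of ?F "s - 1"] by (simp add: mult.commute)
      have "\<bar>?F powr s * (\<beta> * ?w powr (\<beta> - 1) * snd b)\<bar> = ?F powr s * (\<bar>\<beta>\<bar> * ?w powr (\<beta> - 1) * \<bar>snd b\<bar>)"
        by (simp add: abs_mult)
      also have "\<dots> \<le> ?F powr s * (\<bar>\<beta>\<bar> * ?w powr (\<beta> - 1) * 1)"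
        using sb by (intro mult_left_mono) auto
      also have "\<dots> = ?F powr (s - 1) * ?w powr \<beta> * (\<bar>\<beta>\<bar> * ?F / ?w)"
      proof -
        have "?w powr (\<beta> - 1) = ?w powr \<beta> / ?w" using w by (simp add: powr_diff)
        then show ?thesis unfolding Fs by (simp only: times_divide_eq_right times_divide_eq_left mult_1_right mult_ac)
      qed
      finally have 2: "\<bar>?F powr s * (\<beta> * ?w powr (\<beta> - 1) * snd b)\<bar> \<le> ?F powr (s - 1) * ?w powr \<beta> * (\<bar>\<beta>\<bar> * ?F / ?w)" .
      have "?G t = s * ?F powr (s - 1) * norm (grad f (?y t)) * ?w powr \<beta> + ?F powr (s - 1) * ?w powr \<beta> * (\<bar>\<beta>\<bar> * ?F / ?w)"
        unfolding power_gradient_bound_def by (simp only: ring_distribs mult_ac)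
      with 1 2 show ?thesis unfolding v'_def by linarith
    qed
  qed (auto intro!: continuous_intros)
  also have "\<dots> \<le> (\<integral>\<^sup>+t. ennreal (?G t) * indicator upper_half_space (?y t) \<partial>lborel)"
    using pos by (intro nn_integral_mono) (auto simp: upper_half_space_def split: split_indicator)
  finally show ?thesis unfolding v_def by simp
qed

section \<open>Gagliardo-Nirenberg with weight, and splitting of the gradient term\<close>

lemma powr_divide_power:
  fixes B :: real
  assumes "0 \<le> B" "0 < m" "0 < n"
  shows "(B powr (real n / real m)) ^ m = B ^ n"
proof (cases "B = 0")
  case False
  then have "0 < B" using assms by simp
  then show ?thesis using assms by (simp add: powr_powr flip: powr_realpow)
qed (use assms in \<open>simp add: zero_power\<close>)

lemma ennreal_power_le_imp_le:
  assumes "X ^ m \<le> ennreal c ^ m" "0 \<le> c" "0 < m"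
  shows "X \<le> ennreal c"
proof (cases X)
  case (real r)
  then have "r ^ m \<le> c ^ m" using assms by (simp add: ennreal_power)
  then have "r \<le> c" using assms real by simp
  then show ?thesis using real by (simp add: ennreal_leI)
next
  case top
  then have "top \<le> ennreal (c ^ m)" using assms by (simp add: ennreal_power)
  then show ?thesis by (simp add: top_unique)
qed

text \<open>Gagliardo's inequality for h = v^(N/(N-1)), v = |f|^s (1 + x_N)^\<beta>: h^(N-1) = v^N
  is at most the product of the N ray integrals through the point. All directions share one
  integrand, so the product of the full integrals is bounded by \<open>B\<close> to the power
  N.\<close>

lemma weighted_Gagliardo_Nirenberg:
  fixes f :: "'m::finite pt \<Rightarrow> real"
  defines "n \<equiv> real CARD('m) + 1"
  assumes f: "C1_compact_support f" and s: "1 < s" and B: "0 \<le> B"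
    and le: "(\<integral>\<^sup>+x\<in>upper_half_space. ennreal (power_gradient_bound s \<beta> f x) \<partial>lborel) \<le> ennreal B"
  shows "weighted_mass (s * n / (n - 1)) (\<beta> * n / (n - 1)) f \<le> ennreal (B powr (n / (n - 1)))"
proof -
  note [measurable] = C1_compact_support_measurable[OF f]
  let ?H = "upper_half_space :: 'm pt set" and ?n = "DIM('m pt)" and ?m = "DIM('m pt) - 1"
  let ?V = "\<lambda>x. \<bar>f x\<bar> powr s * (1 + snd x) powr \<beta>" and ?G = "power_gradient_bound s \<beta> f"
  let ?h = "\<lambda>x. ennreal (?V x powr (n / (n - 1))) * indicator ?H x"
  have dim: "?n = CARD('m) + 1" by (simp add: DIM_prod DIM_cart)
  have m1: "CARD('m) \<ge> 1" by (simp add: Suc_le_eq)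
  have n: "n = real ?n" "n - 1 = real ?m" "?m > 0" "?n \<ge> 2" using m1 by (auto simp: n_def dim)
  have nm: "n / (n - 1) = real ?n / real ?m" unfolding n(2) unfolding n(1) ..
  have V0: "0 \<le> ?V x" for x by simp
  have hm: "(?V x powr (n / (n - 1))) ^ ?m = ?V x ^ ?n" for x
    unfolding nm using n(3,4) by (intro powr_divide_power) auto
  have mass: "weighted_mass (s * n / (n - 1)) (\<beta> * n / (n - 1)) f = (\<integral>\<^sup>+x. ?h x \<partial>lborel)"
    unfolding weighted_mass_def
    by (intro nn_integral_cong) (auto simp: powr_mult powr_powr upper_half_space_def split: split_indicator)
  have G [measurable]: "?G \<in> borel_measurable borel"
    unfolding power_gradient_bound_def by measurable
  have "(\<integral>\<^sup>+x. ?h x \<partial>lborel) ^ ?m \<le> (\<Prod>b\<in>(Basis :: 'm pt set). \<integral>\<^sup>+x. ennreal (?G x) * indicator ?H x \<partial>lborel)"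
  proof (rule Gagliardo_nn_integral[OF n(4)])
    fix x
    show "?h x ^ ?m \<le> (\<Prod>b\<in>Basis. \<integral>\<^sup>+t. ennreal (?G (x + t *\<^sub>R b)) * indicator ?H (x + t *\<^sub>R b) \<partial>lborel)"
    proof (cases "x \<in> ?H")
      case True
      then have "?h x ^ ?m = ennreal (?V x) ^ ?n"
        by (simp only: indicator_simps mult_1_right ennreal_power powr_ge_zero hm V0)
      also have "\<dots> = (\<Prod>b\<in>(Basis :: 'm pt set). ennreal (?V x))" by simp
      also have "\<dots> \<le> (\<Prod>b\<in>Basis. \<integral>\<^sup>+t. ennreal (?G (x + t *\<^sub>R b)) * indicator ?H (x + t *\<^sub>R b) \<partial>lborel)"
        by (intro prod_mono_ennreal abs_powr_mult_powr_le_ray_integral f s True)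
      finally show ?thesis .
    next
      case False
      then show ?thesis using n(3) by (simp add: zero_power)
    qed
  qed measurable
  also have "\<dots> \<le> (\<Prod>b\<in>(Basis :: 'm pt set). ennreal B)"
    by (intro prod_mono_ennreal le)
  also have "\<dots> = ennreal ((B powr (n / (n - 1))) ^ ?m)"
  proof -
    have "(B powr (n / (n - 1))) ^ ?m = B ^ ?n"
      unfolding nm using n(3,4) B by (intro powr_divide_power) auto
    then show ?thesis by (simp only: prod_constant ennreal_power B)
  qed
  finally have "(\<integral>\<^sup>+x. ?h x \<partial>lborel) ^ ?m \<le> ennreal (B powr (n / (n - 1))) ^ ?m"
    by (simp add: ennreal_power)
  then have "(\<integral>\<^sup>+x. ?h x \<partial>lborel) \<le> ennreal (B powr (n / (n - 1)))"
    using n(3) by (intro ennreal_power_le_imp_le) auto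
  then show ?thesis unfolding mass .
qed

text \<open>The left-hand side is the weight exponent that Young's inequality leaves on |grad f|^p;
  it is to be replaced by \<gamma>. For \<gamma> \<le> p it is at most 0, while \<gamma> > p - 1 >
  0; otherwise 1 - p/n lies in [0, 1] and it is at most \<gamma> - p.\<close>

lemma weight_exponent_le:
  fixes p \<gamma> n :: real
  assumes "1 < p" "p \<le> n" "p - 1 < \<gamma>"
  shows "(\<gamma> - p) * (1 - p / n) \<le> \<gamma>"
proof -
  have "0 \<le> 1 - p / n" "1 - p / n \<le> 1" using assms by auto
  then have "(\<gamma> - p) * (1 - p / n) \<le> max 0 (\<gamma> - p)"
    by (cases "\<gamma> \<le> p") (auto simp: mult_nonpos_nonneg mult_left_le max_def)
  also have "\<dots> \<le> \<gamma>" using assms by auto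
  finally show ?thesis .
qed

lemma power_gradient_bound_le_aux:
  fixes F D w s p \<gamma> n \<kappa> :: real
  defines "\<beta> \<equiv> (\<gamma> - p) * (n - 1) / n"
  assumes F: "0 \<le> F" "0 \<le> D" "1 \<le> w" and s: "1 < s" and p: "1 < p" "p \<le> n" "p - 1 < \<gamma>" and \<kappa>: "0 < \<kappa>"
  shows "F powr (s - 1) * w powr \<beta> * (s * D + \<bar>\<beta>\<bar> * F / w)
    \<le> \<kappa> * (F powr ((s - 1) * p / (p - 1)) * w powr (\<gamma> - p))
      + \<kappa> powr (1 - p) * (2 powr p * (s powr p + \<bar>\<beta>\<bar> powr p)
          * (w powr \<gamma> * D powr p + F powr p * w powr (\<gamma> - p)))"
proof -
  define e where "e = \<gamma> - p"
  \<comment> \<open>\<open>a powr p\<close> must carry the weight exponent \<open>e\<close>, so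
    \<open>a powr (p - 1)\<close> takes the part e (p - 1)/p of \<beta>, and \<open>c\<close> is
    what remains for \<open>b\<close>.\<close>
  define c where "c = \<beta> - e * (p - 1) / p"
  define a where "a = F powr ((s - 1) / (p - 1)) * w powr (e / p)"
  define b where "b = w powr c * (s * D + \<bar>\<beta>\<bar> * F / w)"
  have w: "0 < w" using F by simp
  have b0: "0 \<le> b" unfolding b_def using F s by simp
  have a1: "a powr (p - 1) = F powr (s - 1) * w powr (e * (p - 1) / p)"
    unfolding a_def using p by (simp add: powr_mult powr_powr)
  have a2: "a powr p = F powr ((s - 1) * p / (p - 1)) * w powr e"
    unfolding a_def using p by (simp add: powr_mult powr_powr)
  have lhs: "a powr (p - 1) * b = F powr (s - 1) * w powr \<beta> * (s * D + \<bar>\<beta>\<bar> * F / w)"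
  proof -
    have "w powr (e * (p - 1) / p) * w powr c = w powr \<beta>"
      unfolding powr_add[symmetric] c_def by simp
    from this[symmetric] show ?thesis unfolding a1 b_def by (simp only: mult_ac)
  qed
  have pc: "p * c = (\<gamma> - p) * (1 - p / n)"
    unfolding c_def \<beta>_def e_def using p by (simp add: field_simps)
  then have pc1: "p * c \<le> \<gamma>" using weight_exponent_le[OF p] by simp
  have "b powr p = w powr (p * c) * (s * D + \<bar>\<beta>\<bar> * F / w) powr p"
    unfolding b_def using F s by (simp add: powr_mult powr_powr mult.commute)
  also have "\<dots> \<le> w powr (p * c) * (2 powr p * ((s * D) powr p + (\<bar>\<beta>\<bar> * F / w) powr p))"
    using F s p by (intro mult_left_mono add_powr_le) auto
  also have "\<dots> = 2 powr p * (s powr p * (w powr (p * c) * D powr p) + \<bar>\<beta>\<bar> powr p * (F powr p * w powr (p * c - p)))"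
  proof -
    have "(s * D) powr p = s powr p * D powr p" "(\<bar>\<beta>\<bar> * F / w) powr p = \<bar>\<beta>\<bar> powr p * F powr p / w powr p"
      by (simp_all only: powr_mult powr_divide)
    then show ?thesis unfolding powr_diff by (simp only: ring_distribs times_divide_eq_right times_divide_eq_left mult_ac)
  qed
  \<comment> \<open>Here w \<ge> 1 enters: raising the exponent p c to \<gamma> enlarges both
    terms.\<close>
  also have "\<dots> \<le> 2 powr p * (s powr p * (w powr \<gamma> * D powr p) + \<bar>\<beta>\<bar> powr p * (F powr p * w powr e))"
    using F pc1 by (intro mult_left_mono add_mono mult_right_mono powr_mono) (auto simp: e_def)
  also have "\<dots> \<le> 2 powr p * ((s powr p + \<bar>\<beta>\<bar> powr p) * (w powr \<gamma> * D powr p + F powr p * w powr e))"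
    by (intro mult_left_mono) (auto simp: ring_distribs)
  finally have b1: "b powr p \<le> 2 powr p * (s powr p + \<bar>\<beta>\<bar> powr p) * (w powr \<gamma> * D powr p + F powr p * w powr e)"
    by (simp only: mult.assoc)
  have "a powr (p - 1) * b \<le> \<kappa> * a powr p + \<kappa> powr (1 - p) * b powr p"
    using b0 \<kappa> p by (intro powr_mult_le) (auto simp: a_def)
  also have "\<dots> \<le> \<kappa> * a powr p + \<kappa> powr (1 - p) * (2 powr p * (s powr p + \<bar>\<beta>\<bar> powr p) * (w powr \<gamma> * D powr p + F powr p * w powr e))"
    using b1 by (intro add_left_mono mult_left_mono) auto
  finally show ?thesis unfolding lhs a2 by (simp only: e_def)
qed

text \<open>The derivative of |f|^p (1 + x_N)^(2 \<alpha>) in x_N contains 2 \<alpha> |f|^p (1 +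
  x_N)^(\<gamma> - p), because 2 \<alpha> - 1 = \<gamma> - p. Young's inequality spends half of this
  on the term with the gradient and leaves the factor \<alpha>, positive since \<gamma> > p -
  1.\<close>

lemma weighted_Hardy:
  fixes f :: "'m::finite pt \<Rightarrow> real"
  assumes f: "C1_compact_support f" and p: "1 < p" "p - 1 < \<gamma>"
  defines "\<alpha> \<equiv> (\<gamma> - p + 1) / 2"
  shows "ennreal \<alpha> * weighted_mass p (\<gamma> - p) f \<le> ennreal (p * (\<alpha> / p) powr (1 - p)) * weighted_energy p \<gamma> (grad f)"
proof -
  note [measurable] = C1_compact_support_measurable[OF f]
  obtain R where R: "R > 0" "\<And>y. R \<le> norm y \<Longrightarrow> f y = 0"
    using f unfolding C1_compact_support_def by blast
  have \<alpha>: "\<alpha> > 0" using p by (simp add: \<alpha>_def)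
  define C where "C = p * (\<alpha> / p) powr (1 - p)"
  have C: "C \<ge> 0" unfolding C_def using p by simp
  let ?F = "\<lambda>x. \<alpha> * (\<bar>f x\<bar> powr p * (1 + snd x) powr (\<gamma> - p))"
  let ?A = "\<lambda>x. C * ((1 + snd x) powr \<gamma> * norm (grad f x) powr p)"
  let ?H = "upper_half_space :: 'm pt set"
  let ?e = "(0, 1) :: 'm pt"
  have slice: "(\<integral>\<^sup>+t. ennreal (?F (z, t)) * indicator ?H (z, t) \<partial>lborel) \<le> (\<integral>\<^sup>+t. ennreal (?A (z, t)) * indicator ?H (z, t) \<partial>lborel)" for z
  proof -
    let ?y = "\<lambda>t. (z, 0) + t *\<^sub>R ?e"
    have y: "?y t = (z, t)" for t by simp
    define v where "v = (\<lambda>t. \<bar>f (?y t)\<bar> powr p * (1 + snd (?y t)) powr (2 * \<alpha>))"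
    define v' where "v' = (\<lambda>t. p * \<bar>f (?y t)\<bar> powr (p - 1) * sgn (f (?y t)) * (?e \<bullet> grad f (?y t)) * (1 + snd (?y t)) powr (2 * \<alpha>)
     + \<bar>f (?y t)\<bar> powr p * (2 * \<alpha> * (1 + snd (?y t)) powr (2 * \<alpha> - 1) * snd ?e))"
    have "ennreal (v 0) + (\<integral>\<^sup>+t\<in>{0..R}. ennreal (?F (?y t)) \<partial>lborel) \<le> (\<integral>\<^sup>+t\<in>{0..R}. ennreal (?A (?y t)) \<partial>lborel)"
    proof (rule FTC_nn_integral_le[of R v v' "\<lambda>t. ?F (?y t)" "\<lambda>t. ?A (?y t)"])
      show "0 \<le> R" using R by simp
      show "(v has_real_derivative v' t) (at t)" if "t \<in> {0..R}" for t
        unfolding v_def v'_def using that by (intro abs_powr_mult_powr_has_derivative f p) auto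
      have "norm (?y R) \<ge> R" using norm_snd_le[of R z] R by simp
      then show "v R = 0" unfolding v_def using R(2) by simp
      show "0 \<le> v 0" unfolding v_def by simp
      have cy: "continuous_on {0..R} ?y" by (intro continuous_intros)
      have cf: "continuous_on {0..R} (\<lambda>t. f (?y t))"
        by (rule continuous_on_compose2[OF C1_compact_support_continuous[OF f, of UNIV] cy]) simp
      have cg: "continuous_on {0..R} (\<lambda>t. grad f (?y t))"
        by (rule continuous_on_compose2[OF C1_compact_support_continuous_grad[OF f, of UNIV] cy]) simp
      have cw: "continuous_on {0..R} (\<lambda>t. (1 + snd (?y t)) powr b)" for b
        by (intro continuous_on_powr' continuous_intros) simp
      show "continuous_on {0..R} (\<lambda>t. ?F (?y t))"
        by (intro continuous_on_mult continuous_on_const cw continuous_on_powr' continuous_on_rabs cf) (use p in auto)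
      show "continuous_on {0..R} (\<lambda>t. ?A (?y t))"
        by (intro continuous_on_mult continuous_on_const cw continuous_on_powr' continuous_on_norm cg) (use p in auto)
      show "0 \<le> ?F (?y t)" "0 \<le> ?A (?y t)" if "t \<in> {0..R}" for t using \<alpha> C by simp_all
      show "?F (?y t) - ?A (?y t) \<le> v' t" if t: "t \<in> {0..R}" for t
      proof -
        let ?f = "\<bar>f (?y t)\<bar>" and ?w = "1 + snd (?y t)" and ?D = "norm (grad f (?y t))"
        have w: "?w \<ge> 1" using t by simp
        have "\<bar>p * ?f powr (p - 1) * sgn (f (?y t)) * (?e \<bullet> grad f (?y t)) * ?w powr (2 * \<alpha>)\<bar>
          = p * ?f powr (p - 1) * \<bar>sgn (f (?y t))\<bar> * \<bar>?e \<bullet> grad f (?y t)\<bar> * ?w powr (2 * \<alpha>)"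
          using p by (simp add: abs_mult)
        also have "\<dots> \<le> p * ?f powr (p - 1) * 1 * ?D * ?w powr (2 * \<alpha>)"
          using p Cauchy_Schwarz_ineq2[of ?e "grad f (?y t)"]
          by (intro mult_mono order_refl mult_nonneg_nonneg) (auto simp: sgn_if norm_Pair)
        \<comment> \<open>The exponents (\<gamma> - p)(p - 1)/p and \<gamma>/p add up to 2 \<alpha>;
          with this distribution the p-th powers below carry exactly the weights \<gamma> - p and
          \<gamma>.\<close>
        also have "\<dots> = p * ((?f * ?w powr ((\<gamma> - p) / p)) powr (p - 1) * (?D * ?w powr (\<gamma> / p)))"
        proof -
          have "?w powr ((\<gamma> - p) / p * (p - 1)) * ?w powr (\<gamma> / p) = ?w powr (2 * \<alpha>)"
            unfolding powr_add[symmetric] \<alpha>_def using p by (intro arg_cong2[where f = "(powr)"] refl) (simp add: field_simps)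
          from this[symmetric] show ?thesis by (simp only: powr_mult powr_powr mult_1_right mult_ac)
        qed
        \<comment> \<open>The parameter \<alpha>/p makes the first term, after the outer factor p,
          exactly \<open>?F\<close>; the second term is the origin of \<open>C\<close>.\<close>
        also have "\<dots> \<le> p * ((\<alpha> / p) * (?f * ?w powr ((\<gamma> - p) / p)) powr p + (\<alpha> / p) powr (1 - p) * (?D * ?w powr (\<gamma> / p)) powr p)"
          using p \<alpha> by (intro mult_left_mono powr_mult_le) auto
        also have "\<dots> = ?F (?y t) + ?A (?y t)"
        proof -
          have "(\<gamma> - p) / p * p = \<gamma> - p" "\<gamma> / p * p = \<gamma>" using p by simp_all
          then have "(?f * ?w powr ((\<gamma> - p) / p)) powr p = ?f powr p * ?w powr (\<gamma> - p)"
            "(?D * ?w powr (\<gamma> / p)) powr p = ?w powr \<gamma> * ?D powr p"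
            by (simp_all only: powr_mult powr_powr mult.commute)
          moreover have "p * ((\<alpha> / p) * X + K * Y) = \<alpha> * X + (p * K) * Y" for X Y K
            using p by (simp add: ring_distribs)
          ultimately show ?thesis unfolding C_def by (simp only:)
        qed
        finally have 1: "\<bar>p * ?f powr (p - 1) * sgn (f (?y t)) * (?e \<bullet> grad f (?y t)) * ?w powr (2 * \<alpha>)\<bar> \<le> ?F (?y t) + ?A (?y t)" .
        have 2: "?f powr p * (2 * \<alpha> * ?w powr (2 * \<alpha> - 1) * snd ?e) = 2 * ?F (?y t)"
        proof -
          have "2 * \<alpha> - 1 = \<gamma> - p" by (simp add: \<alpha>_def field_simps)
          then show ?thesis by (simp only: snd_conv mult_1_right mult_ac)
        qed
        show ?thesis using 1 2 unfolding v'_def by linarith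
      qed
    qed
    then have "(\<integral>\<^sup>+t\<in>{0..R}. ennreal (?F (z, t)) \<partial>lborel) \<le> (\<integral>\<^sup>+t\<in>{0..R}. ennreal (?A (z, t)) \<partial>lborel)"
      unfolding y by (meson add_increasing order_trans zero_le order_refl)
    moreover have "(\<integral>\<^sup>+t. ennreal (?F (z, t)) * indicator ?H (z, t) \<partial>lborel) \<le> (\<integral>\<^sup>+t\<in>{0..R}. ennreal (?F (z, t)) \<partial>lborel)"
    proof (intro nn_integral_mono)
      fix t
      have "f (z, t) = 0" if "t > R"
        using R(2)[of "(z, t)"] norm_snd_le[of t z] that by simp
      then show "ennreal (?F (z, t)) * indicator ?H (z, t) \<le> ennreal (?F (z, t)) * indicator {0..R} t"
        using p by (cases "t > R") (auto simp: upper_half_space_def split: split_indicator)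
    qed
    \<comment> \<open>The interval contains t = 0, the half-space does not; the difference is a null
      set.\<close>
    moreover have "(\<integral>\<^sup>+t\<in>{0..R}. ennreal (?A (z, t)) \<partial>lborel) \<le> (\<integral>\<^sup>+t. ennreal (?A (z, t)) * indicator ?H (z, t) \<partial>lborel)"
    proof (rule nn_integral_mono_AE, rule eventually_mono[OF AE_lborel_singleton[of 0]])
      fix t :: real assume "t \<noteq> 0"
      then show "ennreal (?A (z, t)) * indicator {0..R} t \<le> ennreal (?A (z, t)) * indicator ?H (z, t)"
        by (auto simp: upper_half_space_def split: split_indicator)
    qed
    ultimately show ?thesis by (meson order_trans)
  qed
  have fubini: "(\<integral>\<^sup>+x\<in>?H. g x \<partial>lborel) = (\<integral>\<^sup>+z. \<integral>\<^sup>+t. g (z, t) * indicator ?H (z, t) \<partial>lborel \<partial>lborel)"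
    if [measurable]: "g \<in> borel_measurable borel" for g :: "'m pt \<Rightarrow> ennreal"
  proof -
    have "(\<lambda>x. g x * indicator ?H x) \<in> borel_measurable (lborel \<Otimes>\<^sub>M lborel)"
      unfolding lborel_prod by measurable
    from lborel.nn_integral_fst[OF this] show ?thesis unfolding lborel_prod by (rule sym)
  qed
  have F: "(\<lambda>x. ennreal (?F x)) \<in> borel_measurable borel" and A: "(\<lambda>x. ennreal (?A x)) \<in> borel_measurable borel"
    by measurable
  have "ennreal \<alpha> * weighted_mass p (\<gamma> - p) f = (\<integral>\<^sup>+x\<in>?H. ennreal (?F x) \<partial>lborel)"
    unfolding weighted_mass_def using \<alpha>
    by (subst nn_integral_cmult[symmetric]) (auto simp: ennreal_mult mult.assoc intro!: nn_integral_cong)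
  also have "\<dots> \<le> (\<integral>\<^sup>+x\<in>?H. ennreal (?A x) \<partial>lborel)"
    unfolding fubini[OF F] fubini[OF A] by (intro nn_integral_mono slice)
  also have "\<dots> = ennreal C * weighted_energy p \<gamma> (grad f)"
    unfolding weighted_energy_def using C
    by (subst nn_integral_cmult[symmetric]) (auto simp: ennreal_mult mult.assoc intro!: nn_integral_cong)
  finally show ?thesis unfolding C_def .
qed

section \<open>Finiteness of mass and energy of test functions\<close>

lemma upper_half_space_nn_integral_finite:
  fixes g :: "'m::finite pt \<Rightarrow> real"
  assumes cont: "continuous_on {x. 0 \<le> snd x} g" and supp: "\<And>x. R \<le> norm x \<Longrightarrow> g x = 0"
  shows "(\<integral>\<^sup>+x\<in>upper_half_space. ennreal (g x) \<partial>lborel) < top"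
proof -
  \<comment> \<open>The closed half-space is taken so that \<open>K\<close> is compact and
    \<open>g\<close> bounded on it; the weights are continuous up to x_N = 0.\<close>
  define K where "K = cball (0 :: 'm pt) R \<inter> {x. 0 \<le> snd x}"
  have "closed {x :: 'm pt. 0 \<le> snd x}" by (intro closed_Collect_le continuous_intros)
  then have K: "compact K" unfolding K_def by (intro compact_Int_closed) auto
  have "continuous_on K g" by (rule continuous_on_subset[OF cont]) (auto simp: K_def)
  then have "compact (g ` K)" using K by (rule compact_continuous_image)
  then have "bounded (g ` K)" by (rule compact_imp_bounded)
  then obtain B where "\<forall>y\<in>g ` K. norm y \<le> B" unfolding bounded_iff ..
  then have B: "g x \<le> B" if "x \<in> K" for x using that by auto
  have "(\<integral>\<^sup>+x\<in>upper_half_space. ennreal (g x) \<partial>lborel) \<le> (\<integral>\<^sup>+x. ennreal B * indicator K x \<partial>lborel)"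
  proof (rule nn_integral_mono)
    fix x
    show "ennreal (g x) * indicator upper_half_space x \<le> ennreal B * indicator K x"
    proof (cases "x \<in> K")
      case True
      then show ?thesis using B[OF True] by (auto split: split_indicator intro: ennreal_leI)
    next
      case False
      then have "x \<notin> upper_half_space \<or> g x = 0"
        using supp[of x] by (auto simp: K_def upper_half_space_def)
      then show ?thesis by auto
    qed
  qed
  also have "\<dots> = ennreal B * emeasure lborel K"
    using K by (intro nn_integral_cmult_indicator) (simp add: borel_compact)
  also have "\<dots> < top"
    using emeasure_compact_finite[OF K] by (simp add: ennreal_mult_less_top)
  finally show ?thesis .
qed

lemma continuous_on_weight:
  "continuous_on {x :: 'm::finite pt. 0 \<le> snd x} (\<lambda>x. (1 + snd x) powr e)"
  by (intro continuous_on_powr' continuous_intros) auto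

text \<open>With a finite mass the estimates become inequalities between reals, where a multiple of
  the mass can be moved to the other side.\<close>

lemma weighted_mass_finite:
  assumes f: "C1_compact_support f" and r: "0 < r"
  shows "weighted_mass r e f < top"
proof -
  obtain R where R: "R > 0" "\<And>y. R \<le> norm y \<Longrightarrow> f y = 0"
    using f unfolding C1_compact_support_def by blast
  have "continuous_on {x. 0 \<le> snd x} (\<lambda>x. \<bar>f x\<bar> powr r * (1 + snd x) powr e)"
    by (intro continuous_on_mult continuous_on_weight continuous_on_powr' continuous_on_rabs
        C1_compact_support_continuous[OF f] continuous_on_const) (use r in auto)
  then show ?thesis
    unfolding weighted_mass_def by (rule upper_half_space_nn_integral_finite[of _ R]) (use R r in simp)
qed

lemma weighted_energy_finite:
  assumes f: "C1_compact_support f" and p: "0 < p"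
  shows "weighted_energy p \<gamma> (grad f) < top"
proof -
  obtain R where R: "R > 0" "\<And>y. R \<le> norm y \<Longrightarrow> f y = 0"
    using f unfolding C1_compact_support_def by blast
  \<comment> \<open>The gradient vanishes where \<open>f\<close> vanishes on a neighbourhood; R + 1
    puts \<open>x\<close> into the open set |y| > R.\<close>
  have supp: "grad f x = 0" if "R + 1 \<le> norm x" for x
  proof -
    have "grad f x = grad (\<lambda>_. 0) x"
    proof (rule grad_cong_open)
      show "open {y :: 'a pt. R < norm y}" by (intro open_Collect_less continuous_intros)
    qed (use that R in auto)
    also have "\<dots> = 0" by (rule grad_eqI) simp
    finally show ?thesis .
  qed
  have "continuous_on {x. 0 \<le> snd x} (\<lambda>x. (1 + snd x) powr \<gamma> * norm (grad f x) powr p)"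
    by (intro continuous_on_mult continuous_on_weight continuous_on_powr' continuous_on_norm
        C1_compact_support_continuous_grad[OF f] continuous_on_const) (use p in auto)
  then show ?thesis
    unfolding weighted_energy_def by (rule upper_half_space_nn_integral_finite[of _ "R + 1"]) (use supp p in simp)
qed

text \<open>Common engine of both cases. The bound \<open>M\<close> at the input exponent is kept
  separate from the conclusion: for p < N it is the very mass to be bounded, for p = N the bound
  reached so far. The factor \<open>1 + M1\<close> is energy plus mass at exponent p, and \<kappa>
  stays free for the absorption.\<close>

lemma weighted_mass_step:
  fixes f :: "'m::finite pt \<Rightarrow> real" and p \<gamma> s :: real
  defines "n \<equiv> real CARD('m) + 1"
  defines "C \<equiv> 2 powr p * (s powr p + \<bar>(\<gamma> - p) * (n - 1) / n\<bar> powr p)"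
  assumes f: "C1_compact_support f" and s: "1 < s" and p: "1 < p" "p \<le> n" "p - 1 < \<gamma>" and \<kappa>: "0 < \<kappa>"
    and M: "0 \<le> M" "weighted_mass ((s - 1) * p / (p - 1)) (\<gamma> - p) f \<le> ennreal M"
    and M1: "0 \<le> M1" "weighted_mass p (\<gamma> - p) f \<le> ennreal M1"
    and E: "weighted_energy p \<gamma> (grad f) \<le> 1"
  shows "weighted_mass (s * n / (n - 1)) (\<gamma> - p) f
    \<le> ennreal ((\<kappa> * M + \<kappa> powr (1 - p) * (C * (1 + M1))) powr (n / (n - 1)))"
proof -
  note [measurable] = C1_compact_support_measurable[OF f]
  let ?H = "upper_half_space :: 'm pt set"
  let ?\<beta> = "(\<gamma> - p) * (n - 1) / n"
  let ?a = "\<lambda>x. \<bar>f x\<bar> powr ((s - 1) * p / (p - 1)) * (1 + snd x) powr (\<gamma> - p)"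
  let ?b = "\<lambda>x. (1 + snd x) powr \<gamma> * norm (grad f x) powr p"
  let ?c = "\<lambda>x. \<bar>f x\<bar> powr p * (1 + snd x) powr (\<gamma> - p)"
  let ?k = "\<kappa> powr (1 - p) * C"
  have C: "0 \<le> C" unfolding C_def by simp
  have k: "0 \<le> ?k" using C by simp
  have n: "n > 1" unfolding n_def by simp
  have "(\<integral>\<^sup>+x\<in>?H. ennreal (power_gradient_bound s ?\<beta> f x) \<partial>lborel)
      \<le> (\<integral>\<^sup>+x. ennreal \<kappa> * (ennreal (?a x) * indicator ?H x)
          + ennreal ?k * (ennreal (?b x) * indicator ?H x + ennreal (?c x) * indicator ?H x) \<partial>lborel)"
  proof (rule nn_integral_mono)
    fix x
    show "ennreal (power_gradient_bound s ?\<beta> f x) * indicator ?H x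
      \<le> ennreal \<kappa> * (ennreal (?a x) * indicator ?H x)
          + ennreal ?k * (ennreal (?b x) * indicator ?H x + ennreal (?c x) * indicator ?H x)"
    proof (cases "x \<in> ?H")
      case True
      then have w: "1 \<le> 1 + snd x" by (simp add: upper_half_space_def)
      have "power_gradient_bound s ?\<beta> f x \<le> \<kappa> * ?a x + \<kappa> powr (1 - p) * (C * (?b x + ?c x))"
        unfolding power_gradient_bound_def C_def
        by (rule power_gradient_bound_le_aux[OF abs_ge_zero norm_ge_zero w s p \<kappa>])
      also have "\<dots> = \<kappa> * ?a x + ?k * (?b x + ?c x)" by (simp only: mult.assoc)
      finally have "ennreal (power_gradient_bound s ?\<beta> f x) \<le> ennreal (\<kappa> * ?a x + ?k * (?b x + ?c x))"
        by (rule ennreal_leI)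
      also have "\<dots> = ennreal \<kappa> * ennreal (?a x) + ennreal ?k * (ennreal (?b x) + ennreal (?c x))"
        using \<kappa> k by (subst ennreal_plus[symmetric], simp, simp, subst ennreal_mult[symmetric], simp, simp,
          subst ennreal_mult[symmetric], simp, simp, subst ennreal_plus[symmetric]) auto
      finally show ?thesis using True by simp
    qed simp
  qed
  also have "\<dots> = ennreal \<kappa> * weighted_mass ((s - 1) * p / (p - 1)) (\<gamma> - p) f
      + ennreal ?k * (weighted_energy p \<gamma> (grad f) + weighted_mass p (\<gamma> - p) f)"
    unfolding weighted_mass_def weighted_energy_def
    by (subst nn_integral_add, measurable, subst nn_integral_cmult, measurable,
        subst nn_integral_cmult, measurable, subst nn_integral_add, measurable)
  also have "\<dots> \<le> ennreal \<kappa> * ennreal M + ennreal ?k * (1 + ennreal M1)"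
    using M M1 E by (intro add_mono mult_left_mono) auto
  also have "\<dots> = ennreal (\<kappa> * M + ?k * (1 + M1))"
  proof -
    have "1 + ennreal M1 = ennreal (1 + M1)" using M1 by simp
    moreover have "ennreal \<kappa> * ennreal M + ennreal k * ennreal (1 + M1) = ennreal (\<kappa> * M + k * (1 + M1))"
      if "0 \<le> k" for k
      using that M(1) M1(1) \<kappa>
      by (simp only: ennreal_plus ennreal_mult mult_nonneg_nonneg add_nonneg_nonneg less_imp_le zero_le_one)
    ultimately show ?thesis using k by (simp only:)
  qed
  finally have le: "(\<integral>\<^sup>+x\<in>?H. ennreal (power_gradient_bound s ?\<beta> f x) \<partial>lborel) \<le> ennreal (\<kappa> * M + ?k * (1 + M1))" .
  have "0 \<le> \<kappa> * M + ?k * (1 + M1)" using M(1) M1(1) \<kappa> k C by (intro add_nonneg_nonneg mult_nonneg_nonneg) auto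
  from weighted_Gagliardo_Nirenberg[OF f s this le]
  have "weighted_mass (s * n / (n - 1)) (?\<beta> * n / (n - 1)) f \<le> ennreal ((\<kappa> * M + ?k * (1 + M1)) powr (n / (n - 1)))"
    unfolding n_def .
  moreover have "?\<beta> * n / (n - 1) = \<gamma> - p" using n by simp
  ultimately show ?thesis by (simp only: mult.assoc)
qed

text \<open>Holds pointwise: |t|^q is at most |t|^a for |t| \<le> 1 and at most |t|^b otherwise. The
  sum is not homogeneous, which is harmless under the normalisation of the energy.\<close>

lemma weighted_mass_interpolate:
  fixes f :: "'m::finite pt \<Rightarrow> real"
  assumes f: "C1_compact_support f" and q: "a \<le> q" "q \<le> b"
  shows "weighted_mass q e f \<le> weighted_mass a e f + weighted_mass b e f"
proof -
  note [measurable] = C1_compact_support_measurable[OF f]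
  let ?H = "upper_half_space :: 'm pt set"
  have pt: "\<bar>t\<bar> powr q \<le> \<bar>t\<bar> powr a + \<bar>t\<bar> powr b" for t :: real
  proof (cases "\<bar>t\<bar> \<le> 1")
    case True
    then have "\<bar>t\<bar> powr q \<le> \<bar>t\<bar> powr a" using q by (intro powr_mono') auto
    then show ?thesis by (smt (verit) powr_ge_zero)
  next
    case False
    then have "\<bar>t\<bar> powr q \<le> \<bar>t\<bar> powr b" using q by (intro powr_mono) auto
    then show ?thesis by (smt (verit) powr_ge_zero)
  qed
  have "weighted_mass q e f \<le> (\<integral>\<^sup>+x. ennreal (\<bar>f x\<bar> powr a * (1 + snd x) powr e) * indicator ?H x
      + ennreal (\<bar>f x\<bar> powr b * (1 + snd x) powr e) * indicator ?H x \<partial>lborel)"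
    unfolding weighted_mass_def
  proof (rule nn_integral_mono)
    fix x
    have "\<bar>f x\<bar> powr q * (1 + snd x) powr e \<le> \<bar>f x\<bar> powr a * (1 + snd x) powr e + \<bar>f x\<bar> powr b * (1 + snd x) powr e"
      unfolding ring_distribs(2)[symmetric] by (intro mult_right_mono pt) auto
    then have "ennreal (\<bar>f x\<bar> powr q * (1 + snd x) powr e)
        \<le> ennreal (\<bar>f x\<bar> powr a * (1 + snd x) powr e) + ennreal (\<bar>f x\<bar> powr b * (1 + snd x) powr e)"
      by (simp add: ennreal_leI flip: ennreal_plus)
    then show "ennreal (\<bar>f x\<bar> powr q * (1 + snd x) powr e) * indicator ?H x
        \<le> ennreal (\<bar>f x\<bar> powr a * (1 + snd x) powr e) * indicator ?H x
          + ennreal (\<bar>f x\<bar> powr b * (1 + snd x) powr e) * indicator ?H x"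
      by (simp split: split_indicator)
  qed
  also have "\<dots> = weighted_mass a e f + weighted_mass b e f"
    unfolding weighted_mass_def by (rule nn_integral_add) measurable
  finally show ?thesis .
qed

text \<open>The outer exponent n/(n - 1) exceeds 1, so \<kappa> has to depend on M. After taking
  roots the left side is m^(n - 1) with m = M^(1/n), while the remainder is of the order m^(p - 1),
  lower since p < n.\<close>

lemma absorb_power:
  fixes M D n p :: real
  assumes M: "0 \<le> M" and D: "0 \<le> D" and p: "1 < p" "p < n"
    and le: "\<And>\<kappa>. 0 < \<kappa> \<Longrightarrow> M \<le> (\<kappa> * M + \<kappa> powr (1 - p) * D) powr (n / (n - 1))"
  shows "M \<le> (2 powr p * D) powr (n / (n - p))"
proof (cases "M = 0")
  case False
  then have M: "0 < M" using M by simp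
  define m where "m = M powr (1 / n)"
  have m: "0 < m" using M by (simp add: m_def)
  have Mm: "M = m powr n" unfolding m_def using M p by (simp add: powr_powr)
  \<comment> \<open>Chosen so that \<kappa> M is exactly half of m^(n - 1).\<close>
  define \<kappa> where "\<kappa> = 1 / (2 * m)"
  have \<kappa>: "0 < \<kappa>" using m by (simp add: \<kappa>_def)
  have "m powr (n - 1) = M powr ((n - 1) / n)" unfolding m_def using p by (simp add: powr_powr)
  also have "\<dots> \<le> ((\<kappa> * M + \<kappa> powr (1 - p) * D) powr (n / (n - 1))) powr ((n - 1) / n)"
    using le[OF \<kappa>] M p by (intro powr_mono2) auto
  also have "\<dots> = \<kappa> * M + \<kappa> powr (1 - p) * D"
    using M D \<kappa> p by (simp add: powr_powr)
  also have "\<kappa> * M = m powr (n - 1) / 2"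
    using m by (simp add: \<kappa>_def Mm powr_diff)
  also have "\<kappa> powr (1 - p) = (2 * m) powr (p - 1)"
    using m powr_minus_divide[of "2 * m" "1 - p"] by (simp add: \<kappa>_def powr_divide)
  also have "\<dots> = 2 powr p / 2 * m powr (p - 1)"
    using m by (simp add: powr_mult powr_diff)
  finally have "m powr (n - 1) \<le> m powr (n - 1) / 2 + (2 powr p / 2 * m powr (p - 1)) * D" .
  moreover have "(2 powr p / 2 * m powr (p - 1)) * D = ((2 powr p * D) * m powr (p - 1)) / 2" by simp
  ultimately have "m powr (n - 1) \<le> (2 powr p * D) * m powr (p - 1)" by linarith
  moreover have "m powr (n - 1) = m powr (n - p) * m powr (p - 1)"
    by (simp flip: powr_add)
  ultimately have "m powr (n - p) \<le> 2 powr p * D" using m by simp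
  then have "(m powr (n - p)) powr (n / (n - p)) \<le> (2 powr p * D) powr (n / (n - p))"
    using p by (intro powr_mono2) auto
  then show ?thesis using p by (simp add: powr_powr Mm)
qed simp

text \<open>By interpolation it suffices to have uniform bounds at p, from Hardy's inequality, and
  at some r \<ge> q.\<close>

lemma energy_bounds_mass:
  fixes p \<gamma> q :: real
  defines "n \<equiv> real CARD('m::finite) + 1"
  assumes p: "1 < p" "p \<le> n" "p - 1 < \<gamma>" and q: "p \<le> q" "p < n \<Longrightarrow> q \<le> n * p / (n - p)"
  shows "\<exists>M\<ge>0. \<forall>f :: 'm pt \<Rightarrow> real. C1_compact_support f \<longrightarrow> weighted_energy p \<gamma> (grad f) \<le> 1
    \<longrightarrow> weighted_mass q (\<gamma> - p) f \<le> ennreal M"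
proof -
  let ?Q = "\<lambda>r. \<exists>M\<ge>0. \<forall>f :: 'm pt \<Rightarrow> real. C1_compact_support f \<longrightarrow> weighted_energy p \<gamma> (grad f) \<le> 1
    \<longrightarrow> weighted_mass r (\<gamma> - p) f \<le> ennreal M"
  have n: "n > 1" unfolding n_def by simp
  have Hardy: "?Q p"
  proof -
    define \<alpha> where "\<alpha> = (\<gamma> - p + 1) / 2"
    define C where "C = p * (\<alpha> / p) powr (1 - p)"
    have \<alpha>: "0 < \<alpha>" unfolding \<alpha>_def using p by simp
    have C: "0 \<le> C" unfolding C_def using p by simp
    have "weighted_mass p (\<gamma> - p) f \<le> ennreal (C / \<alpha>)"
      if f: "C1_compact_support f" and E: "weighted_energy p \<gamma> (grad f) \<le> 1" for f :: "'m pt \<Rightarrow> real"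
    proof -
      have "ennreal \<alpha> * weighted_mass p (\<gamma> - p) f \<le> ennreal C * weighted_energy p \<gamma> (grad f)"
        using weighted_Hardy[OF f p(1,3)] unfolding \<alpha>_def C_def .
      also have "\<dots> \<le> ennreal C * 1" by (intro mult_left_mono E) simp
      finally have le: "ennreal \<alpha> * weighted_mass p (\<gamma> - p) f \<le> ennreal C" by simp
      have "weighted_mass p (\<gamma> - p) f < top" using p by (intro weighted_mass_finite[OF f]) simp
      then obtain X where X: "weighted_mass p (\<gamma> - p) f = ennreal X" "0 \<le> X"
        by (cases "weighted_mass p (\<gamma> - p) f") auto
      then have "\<alpha> * X \<le> C" using le \<alpha> C by (simp add: ennreal_mult[symmetric])
      then show ?thesis unfolding X using \<alpha> by (intro ennreal_leI) (simp add: field_simps)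
    qed
    then show ?thesis using \<alpha> C by (intro exI[of _ "C / \<alpha>"]) auto
  qed
  then obtain M1 where M1: "0 \<le> M1" "\<And>f :: 'm pt \<Rightarrow> real. C1_compact_support f \<Longrightarrow>
      weighted_energy p \<gamma> (grad f) \<le> 1 \<Longrightarrow> weighted_mass p (\<gamma> - p) f \<le> ennreal M1" by blast
  have "\<exists>r\<ge>q. ?Q r"
  proof (cases "p < n")
    case True
    define r where "r = n * p / (n - p)"
    \<comment> \<open>This \<open>s\<close> solves (s - 1) p/(p - 1) = s n/(n - 1), with common
      value r, as \<open>e1\<close> and \<open>e2\<close> record; input and output of the step are
      then the same mass.\<close>
    define s where "s = r * (n - 1) / n"
    have r0: "0 < r" unfolding r_def using True p by simp
    have s1: "s - 1 = n * (p - 1) / (n - p)" unfolding s_def r_def using True n by (simp add: field_simps)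
    have s: "1 < s"
    proof -
      have "0 < s - 1" unfolding s1 using True p n by simp
      then show ?thesis by simp
    qed
    have e1: "(s - 1) * p / (p - 1) = r" unfolding s1 r_def using p by simp
    have e2: "s * n / (n - 1) = r" unfolding s_def using n by simp
    define D where "D = 2 powr p * (s powr p + \<bar>(\<gamma> - p) * (n - 1) / n\<bar> powr p) * (1 + M1)"
    have D: "0 \<le> D" unfolding D_def using M1(1) by simp
    have "weighted_mass r (\<gamma> - p) f \<le> ennreal ((2 powr p * D) powr (n / (n - p)))"
      if f: "C1_compact_support f" and E: "weighted_energy p \<gamma> (grad f) \<le> 1" for f :: "'m pt \<Rightarrow> real"
    proof -
      obtain X where X: "weighted_mass r (\<gamma> - p) f = ennreal X" "0 \<le> X"
        using weighted_mass_finite[OF f r0, of "\<gamma> - p"] by (cases "weighted_mass r (\<gamma> - p) f") auto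
      have "X \<le> (\<kappa> * X + \<kappa> powr (1 - p) * D) powr (n / (n - 1))" if \<kappa>: "0 < \<kappa>" for \<kappa>
      proof -
        have "weighted_mass ((s - 1) * p / (p - 1)) (\<gamma> - p) f \<le> ennreal X" unfolding e1 X(1) ..
        from weighted_mass_step[OF f s p(1) p(2)[unfolded n_def] p(3) \<kappa> X(2) this M1(1) M1(2)[OF f E] E]
        have "weighted_mass r (\<gamma> - p) f \<le> ennreal ((\<kappa> * X + \<kappa> powr (1 - p) * D) powr (n / (n - 1)))"
          unfolding n_def[symmetric] e2 D_def .
        then show ?thesis unfolding X(1) by simp
      qed
      from absorb_power[OF X(2) D p(1) True this] show ?thesis unfolding X(1) by (rule ennreal_leI)
    qed
    then have "?Q r" by (intro exI[of _ "(2 powr p * D) powr (n / (n - p))"]) simp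
    then show ?thesis using q(2)[OF True] unfolding r_def by blast
  next
    case False
    then have pn: "p = n" using p by simp
    have step: "?Q (r + n / (n - 1))" if "?Q r" and r: "0 < r" for r
    proof -
      obtain M where M: "0 \<le> M" "\<And>f :: 'm pt \<Rightarrow> real. C1_compact_support f \<Longrightarrow>
        weighted_energy p \<gamma> (grad f) \<le> 1 \<Longrightarrow> weighted_mass r (\<gamma> - p) f \<le> ennreal M" using \<open>?Q r\<close> by blast
      \<comment> \<open>\<open>s\<close> is chosen to make \<open>r\<close> the input exponent; as p
        = n, the output exponent is r + n/(n - 1). Nothing is absorbed here, so \<kappa> = 1 will
        do.\<close>
      define s where "s = 1 + r * (n - 1) / n"
      have s: "1 < s" unfolding s_def using r n by simp
      have e1: "(s - 1) * p / (p - 1) = r" unfolding s_def pn using n by simp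
      have e2: "s * n / (n - 1) = r + n / (n - 1)" unfolding s_def using n by (simp add: field_simps)
      define D where "D = 2 powr p * (s powr p + \<bar>(\<gamma> - p) * (n - 1) / n\<bar> powr p) * (1 + M1)"
      have "weighted_mass (r + n / (n - 1)) (\<gamma> - p) f \<le> ennreal ((1 * M + 1 powr (1 - p) * D) powr (n / (n - 1)))"
        if f: "C1_compact_support f" and E: "weighted_energy p \<gamma> (grad f) \<le> 1" for f :: "'m pt \<Rightarrow> real"
      proof -
        have "weighted_mass ((s - 1) * p / (p - 1)) (\<gamma> - p) f \<le> ennreal M" unfolding e1 by (rule M(2)[OF f E])
        from weighted_mass_step[OF f s p(1) p(2)[unfolded n_def] p(3) zero_less_one M(1) this M1(1) M1(2)[OF f E] E]
        show ?thesis unfolding n_def[symmetric] e2 D_def .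
      qed
      then show ?thesis by (intro exI[of _ "(1 * M + 1 powr (1 - p) * D) powr (n / (n - 1))"]) simp
    qed
    have "?Q (p + real j * (n / (n - 1)))" for j
    proof (induction j)
      case 0 then show ?case using Hardy by simp
    next
      case (Suc j)
      have "0 < p + real j * (n / (n - 1))" using p n by (intro add_pos_nonneg) auto
      from step[OF Suc this] show ?case by (simp only: of_nat_Suc ring_distribs mult_1_left ac_simps)
    qed
    moreover obtain j where "q < real j * (n / (n - 1))" using ex_less_of_nat_mult[of "n / (n - 1)" q] n by auto
    then have "p + real j * (n / (n - 1)) \<ge> q" using p by simp
    ultimately show ?thesis by blast
  qed
  then obtain r M2 where r: "q \<le> r" and M2: "0 \<le> M2" "\<And>f :: 'm pt \<Rightarrow> real. C1_compact_support f \<Longrightarrow>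
      weighted_energy p \<gamma> (grad f) \<le> 1 \<Longrightarrow> weighted_mass r (\<gamma> - p) f \<le> ennreal M2" by blast
  have "weighted_mass q (\<gamma> - p) f \<le> ennreal (M1 + M2)"
    if f: "C1_compact_support f" and E: "weighted_energy p \<gamma> (grad f) \<le> 1" for f :: "'m pt \<Rightarrow> real"
  proof -
    have "weighted_mass q (\<gamma> - p) f \<le> weighted_mass p (\<gamma> - p) f + weighted_mass r (\<gamma> - p) f"
      by (rule weighted_mass_interpolate[OF f q(1) r])
    also have "\<dots> \<le> ennreal M1 + ennreal M2" by (intro add_mono M1(2) M2(2) f E)
    finally show ?thesis using M1(1) M2(1) by simp
  qed
  then show ?thesis using M1(1) M2(1) by (intro exI[of _ "M1 + M2"]) simp
qed

section \<open>Passage to the completion\<close>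

text \<open>Energy has degree p and mass degree q, so the bound for f/c gives the one for f. An
  upper bound c^p with c > 0, in place of the exact energy, also covers energy 0.\<close>

lemma energy_bounds_mass_scaled:
  fixes f :: "'m::finite pt \<Rightarrow> real"
  assumes M: "0 \<le> M" "\<And>f :: 'm pt \<Rightarrow> real. C1_compact_support f \<Longrightarrow> weighted_energy p \<gamma> (grad f) \<le> 1
      \<Longrightarrow> weighted_mass q e f \<le> ennreal M"
    and f: "C1_compact_support f" and c: "0 < c"
    and E: "weighted_energy p \<gamma> (grad f) \<le> ennreal (c powr p)"
  shows "weighted_mass q e f \<le> ennreal (M * c powr q)"
proof -
  note [measurable] = C1_compact_support_measurable[OF f]
  let ?f = "\<lambda>x. (1 / c) * f x"
  have "weighted_energy p \<gamma> (grad ?f) = ennreal ((1 / c) powr p) * weighted_energy p \<gamma> (grad f)"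
    unfolding weighted_energy_def grad_mult[OF f] using c
    by (subst nn_integral_cmult[symmetric])
      (auto simp: powr_divide norm_divide ennreal_mult[symmetric] mult_ac split: split_indicator intro!: nn_integral_cong)
  also have "\<dots> \<le> ennreal ((1 / c) powr p) * ennreal (c powr p)" by (intro mult_left_mono E) simp
  also have "\<dots> = 1" using c by (simp add: ennreal_mult[symmetric] powr_divide)
  finally have 1: "weighted_mass q e ?f \<le> ennreal M" by (intro M(2) C1_compact_support_mult f)
  have "weighted_mass q e f = ennreal (c powr q) * weighted_mass q e ?f"
    unfolding weighted_mass_def using c
    by (subst nn_integral_cmult[symmetric])
      (auto simp: powr_divide abs_mult ennreal_mult[symmetric] split: split_indicator intro!: nn_integral_cong)
  also have "\<dots> \<le> ennreal (c powr q) * ennreal M" by (intro mult_left_mono 1) simp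
  finally show ?thesis using M(1) by (simp add: ennreal_mult[symmetric] mult.commute)
qed

section \<open>Approximation of elements of the completion by test functions\<close>

lemma nn_integral_lebesgue_on_upper_half_space:
  "(\<integral>\<^sup>+x. F x \<partial>lebesgue_on upper_half_space) = (\<integral>\<^sup>+x\<in>upper_half_space. F x \<partial>lborel)"
  by (subst nn_integral_restrict_space) (simp_all add: nn_integral_completion)

lemma measurable_lebesgue_on_upper_half_space:
  "F \<in> borel_measurable borel \<Longrightarrow> F \<in> borel_measurable (lebesgue_on upper_half_space)"
  by (intro measurable_restrict_space1 measurable_completion) simp

text \<open>The half-space is open, so \<open>grad v\<close> there does not see the arbitrary values
  of \<open>v\<close> elsewhere.\<close>

lemma Cdelta_infty_extension:
  assumes "v \<in> Cdelta_infty"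
  obtains f where "C1_compact_support f" "\<And>x. x \<in> upper_half_space \<Longrightarrow> v x = f x"
    "\<And>x. x \<in> upper_half_space \<Longrightarrow> grad v x = grad f x"
proof -
  obtain f where f: "f \<in> Cc_infty" "\<And>x. x \<in> upper_half_space \<Longrightarrow> v x = f x"
    using assms unfolding Cdelta_infty_def by blast
  have "open (upper_half_space :: 'a pt set)"
    unfolding upper_half_space_def by (intro open_Collect_less continuous_intros)
  then have "grad v x = grad f x" if "x \<in> upper_half_space" for x
    using that f(2) by (rule grad_cong_open)
  with f show thesis by (intro that Cc_infty_imp_C1_compact_support)
qed

lemma weight_divide_eq:
  fixes p \<gamma> :: real
  assumes "x \<in> upper_half_space"
  shows "c / (1 + snd x) powr (p - \<gamma>) = c * (1 + snd x) powr (\<gamma> - p)"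
  using assms powr_minus_divide[of "1 + snd x" "p - \<gamma>"] by (simp add: upper_half_space_def)

text \<open>Convergence of \<open>D_norm\<close> to 0 carries information only if its integrands are
  integrable, a Bochner integral being 0 by default. This provides it for the differences.\<close>

lemma integrable_weighted_power_diff:
  fixes a b :: "'m::finite pt \<Rightarrow> 'b::euclidean_space" and W :: "'m pt \<Rightarrow> real"
  assumes [measurable]: "a \<in> borel_measurable M" "b \<in> borel_measurable M" "W \<in> borel_measurable M"
    and p: "0 \<le> p" and W: "\<And>x. x \<in> space M \<Longrightarrow> 0 \<le> W x"
    and int: "integrable M (\<lambda>x. W x * norm (a x) powr p)" "integrable M (\<lambda>x. W x * norm (b x) powr p)"
  shows "integrable M (\<lambda>x. W x * norm (a x - b x) powr p)"
proof (rule Bochner_Integration.integrable_bound)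
  show "integrable M (\<lambda>x. 2 powr p * (W x * norm (a x) powr p + W x * norm (b x) powr p))"
    using int by (intro integrable_mult_right Bochner_Integration.integrable_add) auto
  show "AE x in M. norm (W x * norm (a x - b x) powr p)
      \<le> norm (2 powr p * (W x * norm (a x) powr p + W x * norm (b x) powr p))"
  proof (rule AE_I2)
    fix x assume x: "x \<in> space M"
    have "norm (a x - b x) powr p \<le> (norm (a x) + norm (b x)) powr p"
      using p by (intro powr_mono2 norm_triangle_ineq4) auto
    also have "\<dots> \<le> 2 powr p * (norm (a x) powr p + norm (b x) powr p)"
      using p by (intro add_powr_le) auto
    finally have "W x * norm (a x - b x) powr p \<le> W x * (2 powr p * (norm (a x) powr p + norm (b x) powr p))"
      using W[OF x] by (intro mult_left_mono)
    also have "\<dots> = 2 powr p * (W x * norm (a x) powr p + W x * norm (b x) powr p)"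
      by (simp only: ring_distribs mult_ac)
    finally show "norm (W x * norm (a x - b x) powr p)
      \<le> norm (2 powr p * (W x * norm (a x) powr p + W x * norm (b x) powr p))"
      using W[OF x] by simp
  qed
qed measurable

text \<open>Supplies what Fatou's lemma needs: convergence almost everywhere and control of the
  energies. Comparing the energies with that of \<open>g\<close> by |a + b|^p \<le> 2^p (|a|^p +
  |b|^p) costs a factor 2^p; the strict inequality for \<open>t\<close> leaves room for an error
  tending to 0.\<close>

lemma D_space_approximation:
  fixes u :: "'m::finite pt \<Rightarrow> real"
  assumes p: "1 < p" and D: "(u, g) \<in> D_space p \<gamma>"
  obtains f where "\<And>k. C1_compact_support (f k)"
    "AE x in lebesgue_on upper_half_space. (\<lambda>k. f k x) \<longlonglongrightarrow> u x"
    "\<And>t. 2 powr p * (\<integral>x. (1 + snd x) powr \<gamma> * norm (g x) powr p \<partial>lebesgue_on upper_half_space) < t \<Longrightarrow>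
      \<forall>\<^sub>F k in sequentially. weighted_energy p \<gamma> (grad (f k)) \<le> ennreal t"
proof -
  let ?H = "upper_half_space :: 'm pt set"
  let ?L = "lebesgue_on ?H"
  have [measurable]: "u \<in> borel_measurable ?L" "g \<in> borel_measurable ?L"
    and ig: "integrable ?L (\<lambda>x. (1 + snd x) powr \<gamma> * norm (g x) powr p)"
    and iu: "integrable ?L (\<lambda>x. \<bar>u x\<bar> powr p / (1 + snd x) powr (p - \<gamma>))"
    using D unfolding D_space_def by auto
  have snd_L [measurable]: "snd \<in> borel_measurable ?L"
    by (rule measurable_lebesgue_on_upper_half_space) simp
  obtain v where v: "\<And>k. v k \<in> Cdelta_infty"
    and lim: "(\<lambda>k. D_norm p \<gamma> (\<lambda>x. v k x - u x) (\<lambda>x. grad (v k) x - g x)) \<longlonglongrightarrow> 0"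
    using D unfolding D_space_def by auto
  have "\<exists>f. C1_compact_support f \<and> (\<forall>x\<in>?H. v k x = f x \<and> grad (v k) x = grad f x)" for k
    using Cdelta_infty_extension[OF v[of k]] by metis
  then obtain f where f: "\<And>k. C1_compact_support (f k)"
    and fv: "\<And>k x. x \<in> ?H \<Longrightarrow> v k x = f k x" "\<And>k x. x \<in> ?H \<Longrightarrow> grad (v k) x = grad (f k) x"
    by metis
  have f_L [measurable]: "f k \<in> borel_measurable ?L" "grad (f k) \<in> borel_measurable ?L" for k
    by (intro measurable_lebesgue_on_upper_half_space C1_compact_support_measurable f)+
  let ?A = "\<lambda>k x. (1 + snd x) powr \<gamma> * norm (grad (f k) x - g x) powr p"
  let ?B = "\<lambda>k x. (1 + snd x) powr (\<gamma> - p) * norm (f k x - u x) powr p"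
  define a where "a = (\<lambda>k. \<integral>x. ?A k x \<partial>?L)"
  define b where "b = (\<lambda>k. \<integral>x. ?B k x \<partial>?L)"
  have a0: "0 \<le> a k" and b0: "0 \<le> b k" for k
    unfolding a_def b_def by (simp_all add: integral_nonneg_AE)
  have Dn: "D_norm p \<gamma> (\<lambda>x. v k x - u x) (\<lambda>x. grad (v k) x - g x) = (a k + b k) powr (1 / p)" for k
    unfolding D_norm_def a_def b_def
    by (intro arg_cong2[where f = "(powr)"] arg_cong2[where f = "(+)"] Bochner_Integration.integral_cong refl)
      (auto simp: fv weight_divide_eq mult.commute)
  have "(\<lambda>k. ((a k + b k) powr (1 / p)) powr p) \<longlonglongrightarrow> 0"
    using p by (intro tendsto_zero_powrI[OF lim[unfolded Dn] tendsto_const]) auto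
  then have ab: "(\<lambda>k. a k + b k) \<longlonglongrightarrow> 0"
    using p a0 b0 by (simp add: powr_powr add_nonneg_nonneg)
  have a: "a \<longlonglongrightarrow> 0"
    by (rule tendsto_sandwich[OF _ _ tendsto_const ab]) (auto simp: a0 b0)
  have b: "b \<longlonglongrightarrow> 0"
    by (rule tendsto_sandwich[OF _ _ tendsto_const ab]) (auto simp: a0 b0)
  have ifB: "integrable ?L (\<lambda>x. (1 + snd x) powr (\<gamma> - p) * norm (f k x) powr p)" for k
  proof (rule integrableI_nonneg)
    show "(\<integral>\<^sup>+x. ennreal ((1 + snd x) powr (\<gamma> - p) * norm (f k x) powr p) \<partial>?L) < \<infinity>"
      using weighted_mass_finite[OF f, of p "\<gamma> - p" k] p
      unfolding weighted_mass_def nn_integral_lebesgue_on_upper_half_space by (simp add: mult.commute)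
  qed (auto, measurable)
  have iuB: "integrable ?L (\<lambda>x. (1 + snd x) powr (\<gamma> - p) * norm (u x) powr p)"
    using iu by (subst (asm) Bochner_Integration.integrable_cong[OF refl, of _ _ "\<lambda>x. (1 + snd x) powr (\<gamma> - p) * norm (u x) powr p"])
      (auto simp: weight_divide_eq mult.commute)
  have iB: "integrable ?L (?B k)" for k
    using p by (intro integrable_weighted_power_diff ifB iuB) (auto, measurable)
  have ifA: "integrable ?L (\<lambda>x. (1 + snd x) powr \<gamma> * norm (grad (f k) x) powr p)" for k
  proof (rule integrableI_nonneg)
    show "(\<integral>\<^sup>+x. ennreal ((1 + snd x) powr \<gamma> * norm (grad (f k) x) powr p) \<partial>?L) < \<infinity>"
      using weighted_energy_finite[OF f, of p \<gamma> k] p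
      unfolding weighted_energy_def nn_integral_lebesgue_on_upper_half_space by simp
  qed (auto, measurable)
  have iA: "integrable ?L (?A k)" for k
    using p by (intro integrable_weighted_power_diff ifA ig) (auto, measurable)
  have "(\<lambda>k. \<integral>x. norm (?B k x) \<partial>?L) \<longlonglongrightarrow> 0" using b unfolding b_def by simp
  \<comment> \<open>Convergence in L1 of the weighted powers gives convergence almost everywhere
    along a subsequence; the energy errors \<open>a\<close> tend to 0 along it as well.\<close>
  from tendsto_L1_AE_subseq[OF iB this] obtain r where r: "strict_mono r"
    and AE: "AE x in ?L. (\<lambda>k. ?B (r k) x) \<longlonglongrightarrow> 0" by blast
  show thesis
  proof (rule that[of "\<lambda>k. f (r k)"])
    show "C1_compact_support (f (r k))" for k by (rule f)
    show "AE x in ?L. (\<lambda>k. f (r k) x) \<longlonglongrightarrow> u x"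
      using AE AE_space
    proof eventually_elim
      case (elim x)
      then have w: "1 + snd x > 0" by (simp add: upper_half_space_def)
      have "(\<lambda>k. (1 + snd x) powr (p - \<gamma>) * ?B (r k) x) \<longlonglongrightarrow> (1 + snd x) powr (p - \<gamma>) * 0"
        by (intro tendsto_mult_left elim(1))
      moreover have "(1 + snd x) powr (p - \<gamma>) * ?B (r k) x = norm (f (r k) x - u x) powr p" for k
        using w by (simp add: mult.assoc[symmetric] flip: powr_add)
      ultimately have "(\<lambda>k. norm (f (r k) x - u x) powr p) \<longlonglongrightarrow> 0" by (simp only: mult_zero_right)
      then have "(\<lambda>k. (norm (f (r k) x - u x) powr p) powr (1 / p)) \<longlonglongrightarrow> 0"
        by (rule tendsto_zero_powrI[OF _ tendsto_const]) (use p in auto)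
      then have "(\<lambda>k. norm (f (r k) x - u x)) \<longlonglongrightarrow> 0" using p by (simp add: powr_powr)
      then show ?case by (rule LIM_zero_cancel[OF tendsto_norm_zero_cancel])
    qed
    fix t
    let ?E = "\<integral>x. (1 + snd x) powr \<gamma> * norm (g x) powr p \<partial>?L"
    assume t: "2 powr p * ?E < t"
    have "(\<lambda>k. 2 powr p * (?E + a k)) \<longlonglongrightarrow> 2 powr p * (?E + 0)" by (intro tendsto_intros a)
    then have "\<forall>\<^sub>F k in sequentially. 2 powr p * (?E + a k) < t" by (rule order_tendstoD(2)) (use t in simp)
    then have ev: "\<forall>\<^sub>F k in sequentially. 2 powr p * (?E + a (r k)) < t"
      using filterlim_subseq[OF r] by (rule eventually_compose_filterlim)
    show "\<forall>\<^sub>F k in sequentially. weighted_energy p \<gamma> (grad (f (r k))) \<le> ennreal t"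
      using ev
    proof eventually_elim
      case (elim k)
      have "weighted_energy p \<gamma> (grad (f (r k))) = (\<integral>\<^sup>+x. ennreal ((1 + snd x) powr \<gamma> * norm (grad (f (r k)) x) powr p) \<partial>?L)"
        unfolding weighted_energy_def nn_integral_lebesgue_on_upper_half_space ..
      also have "\<dots> \<le> (\<integral>\<^sup>+x. ennreal (2 powr p * ((1 + snd x) powr \<gamma> * norm (g x) powr p + ?A (r k) x)) \<partial>?L)"
      proof (intro nn_integral_mono ennreal_leI)
        fix x
        have "norm (grad (f (r k)) x) powr p \<le> (norm (g x) + norm (grad (f (r k)) x - g x)) powr p"
          using p norm_triangle_ineq[of "g x" "grad (f (r k)) x - g x"] by (intro powr_mono2) auto
        also have "\<dots> \<le> 2 powr p * (norm (g x) powr p + norm (grad (f (r k)) x - g x) powr p)"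
          using p by (intro add_powr_le) auto
        finally have "(1 + snd x) powr \<gamma> * norm (grad (f (r k)) x) powr p
          \<le> (1 + snd x) powr \<gamma> * (2 powr p * (norm (g x) powr p + norm (grad (f (r k)) x - g x) powr p))"
          by (intro mult_left_mono) auto
        also have "\<dots> = 2 powr p * ((1 + snd x) powr \<gamma> * norm (g x) powr p + ?A (r k) x)"
          by (simp only: ring_distribs mult_ac)
        finally show "(1 + snd x) powr \<gamma> * norm (grad (f (r k)) x) powr p
          \<le> 2 powr p * ((1 + snd x) powr \<gamma> * norm (g x) powr p + ?A (r k) x)" .
      qed
      also have "\<dots> = ennreal (\<integral>x. 2 powr p * ((1 + snd x) powr \<gamma> * norm (g x) powr p + ?A (r k) x) \<partial>?L)"
        using ig iA by (intro nn_integral_eq_integral) auto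
      also have "(\<integral>x. 2 powr p * ((1 + snd x) powr \<gamma> * norm (g x) powr p + ?A (r k) x) \<partial>?L) = 2 powr p * (?E + a (r k))"
        unfolding a_def using ig iA by (simp add: Bochner_Integration.integral_add)
      also have "ennreal \<dots> \<le> ennreal t" using elim by (intro ennreal_leI) simp
      finally show ?case .
    qed
  qed
qed

theorem theorem2p12:
  fixes N :: nat and p \<gamma> q :: real
  assumes "N = CARD('m::finite) + 1" and "2 \<le> N"
    and "1 < p" and "p \<le> real N" and "p - 1 < \<gamma>"
    and "p \<le> q" and "p < real N \<Longrightarrow> q \<le> real N * p / (real N - p)"
  shows "\<exists>C0>0. \<forall>(u, Du) \<in> (D_space p \<gamma> :: (('m pt \<Rightarrow> real) \<times> ('m pt \<Rightarrow> 'm pt)) set).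
    integrable (lebesgue_on upper_half_space) (\<lambda>x. \<bar>u x\<bar> powr q / (1 + snd x) powr (p - \<gamma>)) \<and>
    (\<integral>x. \<bar>u x\<bar> powr q / (1 + snd x) powr (p - \<gamma>) \<partial>lebesgue_on upper_half_space) powr (p / q)
      \<le> C0 * (\<integral>x. (1 + snd x) powr \<gamma> * norm (Du x) powr p \<partial>lebesgue_on upper_half_space)"
proof -
  let ?H = "upper_half_space :: 'm pt set"
  let ?L = "lebesgue_on ?H"
  have p: "1 < p" "p \<le> real CARD('m) + 1" "p - 1 < \<gamma>" "p \<le> q"
    and q: "p < real CARD('m) + 1 \<Longrightarrow> q \<le> (real CARD('m) + 1) * p / (real CARD('m) + 1 - p)"
    using assms by (auto simp: algebra_simps)
  obtain M where M: "0 \<le> M" "\<And>f :: 'm pt \<Rightarrow> real. C1_compact_support f \<Longrightarrow> weighted_energy p \<gamma> (grad f) \<le> 1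
      \<Longrightarrow> weighted_mass q (\<gamma> - p) f \<le> ennreal M"
    using energy_bounds_mass[OF p q] by blast
  \<comment> \<open>M^(p/q) comes from raising the mass bound to the power p/q, the factor 2^p from
    the approximation.\<close>
  define C where "C = M powr (p / q) * 2 powr p"
  have C: "0 \<le> C" unfolding C_def by simp
  have "integrable ?L (\<lambda>x. \<bar>u x\<bar> powr q / (1 + snd x) powr (p - \<gamma>)) \<and>
      (\<integral>x. \<bar>u x\<bar> powr q / (1 + snd x) powr (p - \<gamma>) \<partial>?L) powr (p / q)
      \<le> C * (\<integral>x. (1 + snd x) powr \<gamma> * norm (g x) powr p \<partial>?L)"
    if D: "(u, g) \<in> D_space p \<gamma>" for u :: "'m pt \<Rightarrow> real" and g
  proof -
    let ?U = "\<lambda>x. \<bar>u x\<bar> powr q / (1 + snd x) powr (p - \<gamma>)"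
    define A where "A = (\<integral>x. (1 + snd x) powr \<gamma> * norm (g x) powr p \<partial>?L)"
    have [measurable]: "u \<in> borel_measurable ?L" using D unfolding D_space_def by auto
    have [measurable]: "snd \<in> borel_measurable ?L"
      by (rule measurable_lebesgue_on_upper_half_space) simp
    have A: "0 \<le> A" unfolding A_def by (simp add: integral_nonneg_AE)
    obtain f where f: "\<And>k. C1_compact_support (f k)" and lim: "AE x in ?L. (\<lambda>k. f k x) \<longlonglongrightarrow> u x"
      and E: "\<And>t. 2 powr p * A < t \<Longrightarrow> \<forall>\<^sub>F k in sequentially. weighted_energy p \<gamma> (grad (f k)) \<le> ennreal t"
      using D_space_approximation[OF p(1) D] unfolding A_def by blast
    have f_L [measurable]: "f k \<in> borel_measurable ?L" for k
      by (intro measurable_lebesgue_on_upper_half_space C1_compact_support_measurable f)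
    \<comment> \<open>The scaling is applied with c = t^(1/p), which must be positive, whereas A may
      be 0; hence the strict inequality.\<close>
    have bound: "(\<integral>\<^sup>+x. ennreal (?U x) \<partial>?L) \<le> ennreal (M * t powr (q / p))" if t: "2 powr p * A < t" for t
    proof -
      let ?V = "\<lambda>k x. ennreal (\<bar>f k x\<bar> powr q * (1 + snd x) powr (\<gamma> - p))"
      have t0: "0 < t" using A t by (smt (verit) mult_nonneg_nonneg powr_ge_zero)
      have ev: "\<forall>\<^sub>F k in sequentially. (\<integral>\<^sup>+x. ?V k x \<partial>?L) \<le> ennreal (M * t powr (q / p))"
        using E[OF t]
      proof eventually_elim
        case (elim k)
        have "weighted_mass q (\<gamma> - p) (f k) \<le> ennreal (M * (t powr (1 / p)) powr q)"
          by (rule energy_bounds_mass_scaled[OF M f]) (use elim t0 p in \<open>auto simp: powr_powr\<close>)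
        then show ?case
          unfolding weighted_mass_def nn_integral_lebesgue_on_upper_half_space by (simp add: powr_powr)
      qed
      have "(\<integral>\<^sup>+x. ennreal (?U x) \<partial>?L) = (\<integral>\<^sup>+x. liminf (\<lambda>k. ?V k x) \<partial>?L)"
      proof (rule nn_integral_cong_AE)
        show "AE x in ?L. ennreal (?U x) = liminf (\<lambda>k. ?V k x)"
          using lim AE_space
        proof eventually_elim
          case (elim x)
          have "(\<lambda>k. \<bar>f k x\<bar> powr q) \<longlonglongrightarrow> \<bar>u x\<bar> powr q"
            using p by (intro tendsto_powr' tendsto_rabs elim tendsto_const) auto
          then have "(\<lambda>k. ?V k x) \<longlonglongrightarrow> ennreal (\<bar>u x\<bar> powr q * (1 + snd x) powr (\<gamma> - p))"
            by (intro tendsto_ennrealI tendsto_mult_right)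
          then have "liminf (\<lambda>k. ?V k x) = ennreal (\<bar>u x\<bar> powr q * (1 + snd x) powr (\<gamma> - p))"
            by (intro lim_imp_Liminf) auto
          then show ?case using elim by (simp add: weight_divide_eq)
        qed
      qed
      also have "\<dots> \<le> liminf (\<lambda>k. \<integral>\<^sup>+x. ?V k x \<partial>?L)"
        by (rule nn_integral_liminf) measurable
      also have "\<dots> \<le> liminf (\<lambda>k. ennreal (M * t powr (q / p)))"
        by (rule Liminf_mono[OF ev])
      also have "\<dots> = ennreal (M * t powr (q / p))" by (rule Liminf_const) simp
      finally show ?thesis .
    qed
    \<comment> \<open>Any admissible \<open>t\<close> gives a finite integral and thus integrability
      of \<open>?U\<close>.\<close>
    have "(\<integral>\<^sup>+x. ennreal (?U x) \<partial>?L) \<le> ennreal (M * (2 powr p * A + 1) powr (q / p))"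
      by (rule bound) simp
    then have int: "integrable ?L ?U"
      by (intro integrableI_nonneg) (auto simp: less_top[symmetric] top_unique intro: le_less_trans)
    define I where "I = (\<integral>x. ?U x \<partial>?L)"
    have I: "0 \<le> I" unfolding I_def by (simp add: integral_nonneg_AE)
    have nI: "(\<integral>\<^sup>+x. ennreal (?U x) \<partial>?L) = ennreal I"
      unfolding I_def using int by (intro nn_integral_eq_integral) auto
    have "I powr (p / q) \<le> M powr (p / q) * t" if t: "2 powr p * A < t" for t
    proof -
      have t0: "0 < t" using A t by (smt (verit) mult_nonneg_nonneg powr_ge_zero)
      have "I \<le> M * t powr (q / p)" using bound[OF t] M(1) unfolding nI by simp
      then have "I powr (p / q) \<le> (M * t powr (q / p)) powr (p / q)" using I p by (intro powr_mono2) auto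
      also have "\<dots> = M powr (p / q) * t" using M(1) t0 p by (simp add: powr_mult powr_powr)
      finally show ?thesis .
    qed
    note le = this
    have "I powr (p / q) \<le> C * A"
    proof (rule field_le_epsilon)
      fix \<epsilon> :: real assume \<epsilon>: "0 < \<epsilon>"
      \<comment> \<open>t = 2^p A + \<delta> approaches the excluded value 2^p A. The summand 1
        keeps the denominator positive when M = 0.\<close>
      define \<delta> where "\<delta> = \<epsilon> / (M powr (p / q) + 1)"
      have K: "0 < M powr (p / q) + 1" by (simp add: add_nonneg_pos)
      have \<delta>: "0 < \<delta>" unfolding \<delta>_def using \<epsilon> K by simp
      have "I powr (p / q) \<le> M powr (p / q) * (2 powr p * A + \<delta>)" using \<delta> by (intro le) simp
      also have "\<dots> = C * A + M powr (p / q) * \<delta>" unfolding C_def by (simp add: algebra_simps)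
      also have "M powr (p / q) * \<delta> \<le> (M powr (p / q) + 1) * \<delta>" using \<delta> by (intro mult_right_mono) auto
      also have "\<dots> = \<epsilon>" unfolding \<delta>_def using K by simp
      finally show "I powr (p / q) \<le> C * A + \<epsilon>" by simp
    qed
    then show ?thesis using int unfolding I_def A_def by simp
  qed
  note main = this
  \<comment> \<open>\<open>C\<close> is 0 when M = 0, but the constant must be positive; the
    integral on the right is nonnegative, so C + 1 serves.\<close>
  have "(C + 1) * (\<integral>x. (1 + snd x) powr \<gamma> * norm (g x) powr p \<partial>?L)
      \<ge> C * (\<integral>x. (1 + snd x) powr \<gamma> * norm (g x) powr p \<partial>?L)" for g :: "'m pt \<Rightarrow> 'm pt"
    by (intro mult_right_mono) (simp_all add: integral_nonneg_AE)
  with main C show ?thesis by (intro exI[of _ "C + 1"]) (force intro: order_trans)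
qed

end
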